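(* Let $A$ be a selfadjoint (possibly unbounded) linear operator in a complex Hilbert space $H$ with null space $N$. Let $f\in H$ and let $y$ in the domain of $A$ satisfy $Ay=f$ and $y\perp N$. For $\delta>0$ let $f_\delta\in H$ satisfy $\|f_\delta-f\|\le\delta$, and for a constant $a>0$ let $u_{a,\delta}(t)$, $t\ge0$, be the solution of $$\dot u_{a,\delta}=i(A+ia)u_{a,\delta}-if_\delta,\qquad u_{a,\delta}(0)=0 .$$ Then there exist $t=t_\delta$ with $\lim_{\delta\to0}t_\delta=\infty$ and $a=a(\delta)>0$ with $\lim_{\delta\to0}a(\delta)=0$ such that $u_\delta:=u_{a(\delta),\delta}(t_\delta)$ satisfies $$\lim_{\delta\to0}\|u_\delta-y\|=0 .$$
   Context: $N=N(A)=\{u: Au=0\}$ is the null space of $A$; $\dot u=du/dt$; $A+ia$ means $A+iaI$ with $I$ the identity. Selfadjoint operators are densely defined and closed. The solution of the Cauchy problem (understood in the mild sense if $A$ is unbounded) is $u_{a,\delta}(t)=\int_0^t e^{i(A+ia)(t-s)}(-if_\delta)\,ds$, where $e^{i(A+ia)t}=e^{-at}e^{iAt}$. *)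

theory Defs
  imports "HOL-Analysis.Analysis"
begin

class complex_vector = real_vector +
  fixes scaleC :: "complex \<Rightarrow> 'a \<Rightarrow> 'a"  (infixr "*\<^sub>C" 75)
  assumes scaleC_add_right: "c *\<^sub>C (x + y) = c *\<^sub>C x + c *\<^sub>C y"
    and scaleC_add_left: "(b + c) *\<^sub>C x = b *\<^sub>C x + c *\<^sub>C x"
    and scaleC_scaleC: "b *\<^sub>C c *\<^sub>C x = (b * c) *\<^sub>C x"
    and scaleC_of_real: "complex_of_real r *\<^sub>C x = r *\<^sub>R x"

(* The inner product is linear in the first argument and conjugate linear in the second;
   positive definiteness is contained in cinner_self. *)
class complex_inner = complex_vector + real_normed_vector +
  fixes cinner :: "'a \<Rightarrow> 'a \<Rightarrow> complex"
  assumes cinner_commute: "cinner x y = cnj (cinner y x)"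
    and cinner_add_left: "cinner (x + y) z = cinner x z + cinner y z"
    and cinner_scaleC_left: "cinner (c *\<^sub>C x) y = c * cinner x y"
    and cinner_self: "cinner x x = complex_of_real ((norm x)\<^sup>2)"

class complex_hilbert = complex_inner + complete_space

instantiation complex :: complex_hilbert
begin

definition scaleC_complex :: "complex \<Rightarrow> complex \<Rightarrow> complex"
  where "scaleC_complex c x = c * x"

definition cinner_complex :: "complex \<Rightarrow> complex \<Rightarrow> complex"
  where "cinner_complex x y = x * cnj y"

instance
proof
  fix b c x y z :: complex and r :: real
  show "c *\<^sub>C (x + y) = c *\<^sub>C x + c *\<^sub>C y"
    by (simp add: scaleC_complex_def distrib_left)
  show "(b + c) *\<^sub>C x = b *\<^sub>C x + c *\<^sub>C x"
    by (simp add: scaleC_complex_def distrib_right)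
  show "b *\<^sub>C c *\<^sub>C x = (b * c) *\<^sub>C x"
    by (simp add: scaleC_complex_def)
  show "complex_of_real r *\<^sub>C x = r *\<^sub>R x"
    by (simp add: scaleC_complex_def scaleR_conv_of_real)
  show "cinner x y = cnj (cinner y x)"
    by (simp add: cinner_complex_def)
  show "cinner (x + y) z = cinner x z + cinner y z"
    by (simp add: cinner_complex_def distrib_right)
  show "cinner (c *\<^sub>C x) y = c * cinner x y"
    by (simp add: cinner_complex_def scaleC_complex_def)
  show "cinner x x = complex_of_real ((norm x)\<^sup>2)"
    unfolding cinner_complex_def by (rule complex_norm_square [symmetric])
qed

end

definition csubspace :: "'a::complex_vector set \<Rightarrow> bool"
  where "csubspace S \<longleftrightarrow>
    0 \<in> S \<and> (\<forall>x\<in>S. \<forall>y\<in>S. x + y \<in> S) \<and> (\<forall>c. \<forall>x\<in>S. c *\<^sub>C x \<in> S)"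

(* A possibly unbounded operator is given by its domain D together with a total function A
   of which only the values on D are relevant. *)

definition linear_operator :: "'a::complex_vector set \<Rightarrow> ('a \<Rightarrow> 'a) \<Rightarrow> bool"
  where "linear_operator D A \<longleftrightarrow> csubspace D \<and>
    (\<forall>x\<in>D. \<forall>y\<in>D. A (x + y) = A x + A y) \<and> (\<forall>c. \<forall>x\<in>D. A (c *\<^sub>C x) = c *\<^sub>C A x)"

definition adjoint_domain :: "'a::complex_inner set \<Rightarrow> ('a \<Rightarrow> 'a) \<Rightarrow> 'a set"
  where "adjoint_domain D A = {y. \<exists>z. \<forall>x\<in>D. cinner (A x) y = cinner x z}"

(* The vector z is unique when D is dense. *)
definition adjoint_op :: "'a::complex_inner set \<Rightarrow> ('a \<Rightarrow> 'a) \<Rightarrow> 'a \<Rightarrow> 'a"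
  where "adjoint_op D A y = (THE z. \<forall>x\<in>D. cinner (A x) y = cinner x z)"

(* Closedness is not listed separately, since every adjoint is closed. *)
definition selfadjoint :: "'a::complex_inner set \<Rightarrow> ('a \<Rightarrow> 'a) \<Rightarrow> bool"
  where "selfadjoint D A \<longleftrightarrow> linear_operator D A \<and> closure D = UNIV \<and>
    adjoint_domain D A = D \<and> (\<forall>x\<in>D. adjoint_op D A x = A x)"

definition null_space :: "'a::complex_vector set \<Rightarrow> ('a \<Rightarrow> 'a) \<Rightarrow> 'a set"
  where "null_space D A = {x \<in> D. A x = 0}"

definition orthogonal_to :: "'a::complex_inner \<Rightarrow> 'a set \<Rightarrow> bool"
  where "orthogonal_to y S \<longleftrightarrow> (\<forall>x\<in>S. cinner y x = 0)"

definition unitary :: "('a::complex_inner \<Rightarrow> 'a) \<Rightarrow> bool"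
  where "unitary V \<longleftrightarrow> linear_operator UNIV V \<and> surj V \<and>
    (\<forall>x y. cinner (V x) (V y) = cinner x y)"

definition unitary_group :: "(real \<Rightarrow> 'a::complex_inner \<Rightarrow> 'a) \<Rightarrow> bool"
  where "unitary_group U \<longleftrightarrow> (\<forall>t. unitary (U t)) \<and> U 0 = id \<and>
    (\<forall>s t. U (s + t) = U s \<circ> U t) \<and> (\<forall>x. continuous_on UNIV (\<lambda>t. U t x))"

(* The infinitesimal generator of U is the operator B with domain D. Only the equivalence for
   all x and z pins down the domain of the generator as well as its values. *)
definition generates ::
    "'a::real_normed_vector set \<Rightarrow> ('a \<Rightarrow> 'a) \<Rightarrow> (real \<Rightarrow> 'a \<Rightarrow> 'a) \<Rightarrow> bool"
  where "generates D B U \<longleftrightarrow>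
    (\<forall>x z. ((\<lambda>h. (U h x - x) /\<^sub>R h) \<longlongrightarrow> z) (at 0) \<longleftrightarrow> x \<in> D \<and> z = B x)"

(* exp (i A t) for selfadjoint A: by Stone's theorem, the unique strongly continuous unitary
   group with generator i A. *)
definition exp_i :: "'a::complex_inner set \<Rightarrow> ('a \<Rightarrow> 'a) \<Rightarrow> real \<Rightarrow> 'a \<Rightarrow> 'a"
  where "exp_i D A = (THE U. unitary_group U \<and> generates D (\<lambda>x. \<i> *\<^sub>C A x) U)"

(* exp (i (A + i a) t) *)
definition exp_i_damped ::
    "'a::complex_inner set \<Rightarrow> ('a \<Rightarrow> 'a) \<Rightarrow> real \<Rightarrow> real \<Rightarrow> 'a \<Rightarrow> 'a"
  where "exp_i_damped D A a t x = exp (- a * t) *\<^sub>R exp_i D A t x"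

(* The mild solution at time t \<ge> 0 of u' = i (A + i a) u - i g, u(0) = 0, given by
   Duhamel's formula. The integrand is continuous in s, so the gauge integral is an ordinary
   vector-valued Riemann integral; unlike the Bochner integral of the library it does not
   require the Hilbert space to be separable. *)
definition mild_solution ::
    "'a::complex_hilbert set \<Rightarrow> ('a \<Rightarrow> 'a) \<Rightarrow> real \<Rightarrow> 'a \<Rightarrow> real \<Rightarrow> 'a"
  where "mild_solution D A a g t =
    integral {0..t} (\<lambda>s. exp_i_damped D A a (t - s) ((- \<i>) *\<^sub>C g))"

end

theory Submission
  imports Defs
begin

text \<open>
  Write U(t) for the unitary group exp (i A t), E(t) = exp (- a t) U(t), and J(v) for the integral
  of E(t - s) v over s in [0, t]. The mild solution is J(- i g). Since U is unitary, the damping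
  gives |J(v)| \<le> |v| / a, so the noise contributes at most \<delta> / a. For the exact datum g = A y the
  integrand is, up to a damping term, the derivative of s \<mapsto> E(t - s) y, and the fundamental theorem
  of calculus gives J(- i A y) = y - E(t) y - a J(y). The term E(t) y is at most exp (- a t) |y|.
  It remains to see that a J(y) vanishes as a tends to 0. This is an Abelian ergodic theorem: as y
  is orthogonal to the null space, it lies in the closure of the range of A, hence
  y = i A w + r with r small; the same identity for w shows that J(i A w) stays below 3 |w|
  independently of a and t, while a J(r) is at most |r|. The choice a = sqrt \<delta>, t = 1 / \<delta> makes
  a, \<delta> / a and exp (- a t) all small. This part is carried by the lemmas
  \<open>duhamel_generator\<close>, \<open>orthogonal_null_space_closure_range\<close> and \<open>norm_mild_solution_diff_le\<close>.

  All of this presupposes Stone's theorem: \<open>exp_i\<close> is a definite description, so one has to know that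
  i A generates exactly one unitary group. The implicit Euler step R(h) = (1 - h i A)^{-1} exists for
  all real h because A is selfadjoint, it is a contraction because i A is skew, and it agrees with
  the sought exponential up to O(h^2) on the domain of A^2. If two commuting contractions P and Q satisfy
  |P x - Q x| \<le> \<epsilon>, then |P^n x - Q^n x| \<le> n \<epsilon> (\<open>contraction_power_diff\<close>). This one inequality,
  fed with the local error \<open>resolvent_add_error\<close>, shows that R(t / 2^k)^(2^k) converges as k grows
  and that the limits satisfy the group law; fed with the definition of the generator, it shows that
  the group is unique (\<open>generated_group_unique\<close>).
\<close>

section \<open>Geometry of complex Hilbert spaces\<close>

text \<open>Integration and the fundamental theorem of calculus are stated for the class of Banach spaces.\<close>

subclass (in complex_hilbert) banach ..

lemma scaleC_zero_left [simp]: "0 *\<^sub>C (x::'a::complex_vector) = 0"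
  using scaleC_of_real[of 0 x] by simp

lemma scaleC_one [simp]: "1 *\<^sub>C (x::'a::complex_vector) = x"
  using scaleC_of_real[of 1 x] by simp

lemma scaleC_minus_left: "(- c) *\<^sub>C (x::'a::complex_vector) = - (c *\<^sub>C x)"
proof -
  have "(- c) *\<^sub>C x + c *\<^sub>C x = 0"
    by (simp flip: scaleC_add_left)
  then show ?thesis by (simp add: add_eq_0_iff2)
qed

lemma scaleC_minus_one: "(- 1) *\<^sub>C (x::'a::complex_vector) = - x"
  by (simp add: scaleC_minus_left)

lemma scaleC_zero_right [simp]: "c *\<^sub>C (0::'a::complex_vector) = 0"
  using scaleC_add_right[of c 0 "0::'a"] by simp

lemma scaleC_minus_right: "c *\<^sub>C (- (x::'a::complex_vector)) = - (c *\<^sub>C x)"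
proof -
  have "c *\<^sub>C (- x) + c *\<^sub>C x = 0"
    by (simp flip: scaleC_add_right)
  then show ?thesis by (simp add: add_eq_0_iff2)
qed

lemma scaleC_diff_right: "c *\<^sub>C ((x::'a::complex_vector) - y) = c *\<^sub>C x - c *\<^sub>C y"
  using scaleC_add_right[of c x "- y"] by (simp add: scaleC_minus_right)

lemma scaleC_scaleR: "c *\<^sub>C r *\<^sub>R (x::'a::complex_vector) = r *\<^sub>R c *\<^sub>C x"
  by (simp add: scaleC_scaleC mult.commute flip: scaleC_of_real)

lemma cinner_zero_left [simp]: "cinner 0 (y::'a::complex_inner) = 0"
  using cinner_add_left[of 0 0 y] by simp

lemma cinner_minus_left: "cinner (- x) (y::'a::complex_inner) = - cinner x y"
  using cinner_add_left[of x "- x" y] by (simp add: add_eq_0_iff)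

lemma cinner_diff_left: "cinner (x - z) (y::'a::complex_inner) = cinner x y - cinner z y"
  using cinner_add_left[of x "- z" y] by (simp add: cinner_minus_left)

lemma cinner_add_right: "cinner x (y + z::'a::complex_inner) = cinner x y + cinner x z"
  by (metis cinner_add_left cinner_commute complex_cnj_add)

lemma cinner_minus_right: "cinner x (- y::'a::complex_inner) = - cinner x y"
  by (metis cinner_minus_left cinner_commute complex_cnj_minus)

lemma cinner_diff_right: "cinner x (y - z::'a::complex_inner) = cinner x y - cinner x z"
  by (metis cinner_diff_left cinner_commute complex_cnj_diff)

lemma cinner_zero_right [simp]: "cinner (x::'a::complex_inner) 0 = 0"
  using cinner_commute[of x 0] by simp

lemma cinner_scaleC_right: "cinner x (c *\<^sub>C y::'a::complex_inner) = cnj c * cinner x y"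
  by (metis cinner_scaleC_left cinner_commute complex_cnj_mult)

lemma cinner_scaleR_left: "cinner (r *\<^sub>R x) (y::'a::complex_inner) = of_real r * cinner x y"
  by (metis cinner_scaleC_left scaleC_of_real)

lemma cinner_scaleR_right: "cinner x (r *\<^sub>R y::'a::complex_inner) = of_real r * cinner x y"
  by (metis cinner_scaleC_right scaleC_of_real complex_cnj_complex_of_real)

lemma norm_sq_eq_cinner: "(norm (x::'a::complex_inner))\<^sup>2 = Re (cinner x x)"
  by (simp add: cinner_self)

lemma norm_scaleC: "norm (c *\<^sub>C (x::'a::complex_inner)) = cmod c * norm x"
proof -
  have "cinner (c *\<^sub>C x) (c *\<^sub>C x) = (c * cnj c) * cinner x x"
    by (simp add: cinner_scaleC_left cinner_scaleC_right)
  also have "\<dots> = of_real ((cmod c)\<^sup>2 * (norm x)\<^sup>2)"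
    unfolding cinner_self complex_norm_square[symmetric] by simp
  finally have "(norm (c *\<^sub>C x))\<^sup>2 = (cmod c * norm x)\<^sup>2"
    by (simp only: norm_sq_eq_cinner[of "c *\<^sub>C x"] Re_complex_of_real power_mult_distrib)
  then show ?thesis by simp
qed

lemma norm_add_sq:
  "(norm (x + y::'a::complex_inner))\<^sup>2 = (norm x)\<^sup>2 + 2 * Re (cinner x y) + (norm y)\<^sup>2"
proof -
  have "Re (cinner y x) = Re (cinner x y)"
    using cinner_commute[of y x] by simp
  then show ?thesis
    by (simp add: norm_sq_eq_cinner cinner_add_left cinner_add_right)
qed

lemma norm_parallelogram:
  "(norm (x + y::'a::complex_inner))\<^sup>2 + (norm (x - y))\<^sup>2 = 2 * (norm x)\<^sup>2 + 2 * (norm y)\<^sup>2"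
  using norm_add_sq[of x y] norm_add_sq[of x "- y"] by (simp add: cinner_minus_right)

text \<open>The quadratic function of c whose minimisation yields both the Cauchy-Schwarz inequality and the
  orthogonality of the best approximation.\<close>

lemma norm_diff_scaleC_sq:
  "(norm (x - c *\<^sub>C y::'a::complex_inner))\<^sup>2
    = (norm x)\<^sup>2 - 2 * Re (cnj c * cinner x y) + (cmod c)\<^sup>2 * (norm y)\<^sup>2"
  using norm_add_sq[of x "- (c *\<^sub>C y)"]
  by (simp add: cinner_minus_right cinner_scaleC_right norm_scaleC power_mult_distrib)

lemma cinner_Cauchy_Schwarz: "cmod (cinner x (y::'a::complex_inner)) \<le> norm x * norm y"
proof (cases "y = 0")
  case False
  \<comment> \<open>With this c, the vector c y is the orthogonal projection of x onto the line through y.\<close>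
  define c where "c = cinner x y / of_real ((norm y)\<^sup>2)"
  have c: "cnj c * cinner x y = of_real ((cmod (cinner x y))\<^sup>2 / (norm y)\<^sup>2)"
    by (simp add: c_def complex_norm_square mult.commute del: of_real_power)
  have "0 \<le> (norm (x - c *\<^sub>C y))\<^sup>2" by simp
  also have "\<dots> = (norm x)\<^sup>2 - (cmod (cinner x y))\<^sup>2 / (norm y)\<^sup>2"
    unfolding norm_diff_scaleC_sq c
    using False by (simp add: c_def norm_divide power_divide power2_eq_square norm_mult)
  finally have "(cmod (cinner x y))\<^sup>2 \<le> (norm x * norm y)\<^sup>2"
    using False by (simp add: field_simps power_mult_distrib)
  then show ?thesis
    by (rule power2_le_imp_le) simp
qed simp

lemma bounded_bilinear_cinner: "bounded_bilinear (cinner :: 'a::complex_inner \<Rightarrow> _)"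
proof
  show "\<exists>K. \<forall>a b::'a. norm (cinner a b) \<le> norm a * norm b * K"
    by (rule exI[of _ 1]) (simp add: cinner_Cauchy_Schwarz)
qed (simp_all add: cinner_add_left cinner_add_right cinner_scaleR_left cinner_scaleR_right
    scaleR_conv_of_real)

lemmas tendsto_cinner = bounded_bilinear.tendsto[OF bounded_bilinear_cinner]

lemma csubspace_diff:
  assumes "csubspace S" "x \<in> S" "y \<in> S"
  shows "x - y \<in> S"
proof -
  have "x + (- 1) *\<^sub>C y \<in> S" using assms unfolding csubspace_def by blast
  then show ?thesis by (simp add: scaleC_minus_one)
qed

lemma csubspace_scaleR:
  assumes "csubspace S" "x \<in> S"
  shows "r *\<^sub>R x \<in> S"
  using assms unfolding csubspace_def by (metis scaleC_of_real)

lemma tendsto_scaleC: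
  fixes f :: "'b \<Rightarrow> 'a::complex_inner"
  assumes "(f \<longlongrightarrow> l) F"
  shows "((\<lambda>n. c *\<^sub>C f n) \<longlongrightarrow> c *\<^sub>C l) F"
proof -
  have "bounded_linear (\<lambda>x::'a. c *\<^sub>C x)"
    by (rule bounded_linear_intro[of _ "cmod c"])
      (simp_all add: scaleC_add_right scaleC_scaleR norm_scaleC)
  then show ?thesis
    using assms by (rule bounded_linear.tendsto)
qed

lemma csubspace_closure:
  fixes S :: "'a::complex_inner set"
  assumes "csubspace S"
  shows "csubspace (closure S)"
  unfolding csubspace_def
proof (intro conjI ballI allI)
  show "0 \<in> closure S"
    using assms closure_subset by (auto simp: csubspace_def)
next
  fix x y assume "x \<in> closure S" "y \<in> closure S"
  then obtain f g where "\<And>n. f n \<in> S" "f \<longlonglongrightarrow> x" "\<And>n. g n \<in> S" "g \<longlonglongrightarrow> y"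
    unfolding closure_sequential by blast
  then show "x + y \<in> closure S"
    using assms unfolding closure_sequential csubspace_def
    by (intro exI[of _ "\<lambda>n. f n + g n"]) (auto intro!: tendsto_add)
next
  fix c x assume "x \<in> closure S"
  then obtain f where "\<And>n. f n \<in> S" "f \<longlonglongrightarrow> x"
    unfolding closure_sequential by blast
  then show "c *\<^sub>C x \<in> closure S"
    using assms unfolding closure_sequential csubspace_def
    by (intro exI[of _ "\<lambda>n. c *\<^sub>C f n"]) (auto intro!: tendsto_scaleC)
qed

lemma best_approximation_exists:
  fixes S :: "'a::complex_hilbert set"
  assumes S: "csubspace S" and closed: "closed S"
  shows "\<exists>p\<in>S. \<forall>s\<in>S. norm (x - p) \<le> norm (x - s)"
proof -
  define d where "d = (INF s\<in>S. (norm (x - s))\<^sup>2)"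
  have ne: "S \<noteq> {}" using S by (auto simp: csubspace_def)
  have bdd: "bdd_below ((\<lambda>s. (norm (x - s))\<^sup>2) ` S)"
    by (rule bdd_belowI[of _ 0]) auto
  have d_le: "d \<le> (norm (x - s))\<^sup>2" if "s \<in> S" for s
    unfolding d_def by (rule cINF_lower[OF bdd that])
  have "\<exists>s\<in>S. (norm (x - s))\<^sup>2 < d + 1 / real (Suc n)" for n
    using cINF_less_iff[OF ne bdd, of "d + 1 / real (Suc n)"] unfolding d_def by simp
  then obtain s where s: "\<And>n. s n \<in> S" "\<And>n. (norm (x - s n))\<^sup>2 < d + 1 / real (Suc n)"
    by metis
  \<comment> \<open>The midpoint of two near-minimisers lies in the subspace, so the parallelogram law
     makes the near-minimisers close to each other.\<close>
  have close: "(norm (s m - s n))\<^sup>2 \<le> 2 / real (Suc m) + 2 / real (Suc n)" for m n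
  proof -
    have "s m + s n \<in> S" using S s(1) by (auto simp: csubspace_def)
    then have "(1/2) *\<^sub>R (s m + s n) \<in> S" by (rule csubspace_scaleR[OF S])
    then have "4 * d \<le> 4 * (norm (x - (1/2) *\<^sub>R (s m + s n)))\<^sup>2"
      using d_le by simp
    also have "\<dots> = (norm (2 *\<^sub>R (x - (1/2) *\<^sub>R (s m + s n))))\<^sup>2"
      by (simp only: norm_scaleR power_mult_distrib) simp
    also have "2 *\<^sub>R (x - (1/2) *\<^sub>R (s m + s n)) = (x - s m) + (x - s n)"
      by (simp add: algebra_simps scaleR_2)
    finally have "4 * d \<le> (norm ((x - s m) + (x - s n)))\<^sup>2" .
    moreover have "(norm (s m - s n))\<^sup>2 + (norm ((x - s m) + (x - s n)))\<^sup>2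
        = 2 * (norm (x - s m))\<^sup>2 + 2 * (norm (x - s n))\<^sup>2"
      using norm_parallelogram[of "x - s m" "x - s n"] norm_minus_commute[of "s m" "s n"] by simp
    moreover have "2 / real (Suc k) = 2 * (1 / real (Suc k))" for k by simp
    ultimately show ?thesis
      using s(2)[of m] s(2)[of n] by linarith
  qed
  have "Cauchy s"
  proof (rule CauchyI)
    fix e :: real assume "e > 0"
    then obtain M where M: "4 / real (Suc M) < e\<^sup>2"
      using reals_Archimedean[of "e\<^sup>2 / 4"] by (auto simp: field_simps)
    have "norm (s m - s n) < e" if "m \<ge> M" "n \<ge> M" for m n
    proof -
      have "2 / real (Suc m) \<le> 2 / real (Suc M)" "2 / real (Suc n) \<le> 2 / real (Suc M)"
        using that by (simp_all add: frac_le)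
      then have "(norm (s m - s n))\<^sup>2 < e\<^sup>2"
        using close[of m n] M by simp
      then show ?thesis
        using \<open>e > 0\<close> by (simp add: power_less_imp_less_base)
    qed
    then show "\<exists>M. \<forall>m\<ge>M. \<forall>n\<ge>M. norm (s m - s n) < e" by blast
  qed
  then obtain p where p: "s \<longlonglongrightarrow> p"
    using Cauchy_convergent convergent_def by blast
  have "p \<in> S" using closed_sequentially[OF closed s(1) p] .
  moreover have "(norm (x - p))\<^sup>2 \<le> d"
  proof (rule LIMSEQ_le)
    show "(\<lambda>n. (norm (x - s n))\<^sup>2) \<longlonglongrightarrow> (norm (x - p))\<^sup>2"
      by (intro tendsto_intros p)
    show "(\<lambda>n. d + 1 / real (Suc n)) \<longlonglongrightarrow> d"
      using tendsto_add[OF tendsto_const[of d] LIMSEQ_inverse_real_of_nat]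
      by (simp add: inverse_eq_divide)
    show "\<exists>N. \<forall>n\<ge>N. (norm (x - s n))\<^sup>2 \<le> d + 1 / real (Suc n)"
      using s(2) less_imp_le by blast
  qed
  ultimately show ?thesis
    using d_le by (meson norm_ge_zero order_trans power2_le_imp_le)
qed

text \<open>The residual of a best approximation p is orthogonal to S: if it had a component along some s in S,
  a small step from p in that direction would come closer to x.\<close>

lemma orthogonal_projection_exists:
  fixes S :: "'a::complex_hilbert set"
  assumes S: "csubspace S" and closed: "closed S"
  shows "\<exists>p\<in>S. \<forall>s\<in>S. cinner (x - p) s = 0"
proof -
  obtain p where p: "p \<in> S" and best: "\<And>s. s \<in> S \<Longrightarrow> norm (x - p) \<le> norm (x - s)"
    using best_approximation_exists[OF assms] by blast
  have "cinner (x - p) s = 0" if "s \<in> S" for s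
  proof (rule ccontr)
    assume nz: "cinner (x - p) s \<noteq> 0"
    define g where "g = (cmod (cinner (x - p) s))\<^sup>2"
    \<comment> \<open>The step length is small enough for the linear gain to outweigh the quadratic loss.\<close>
    define t where "t = 1 / ((norm s)\<^sup>2 + 1)"
    define c where "c = of_real t * cinner (x - p) s"
    have "t > 0" "t * (norm s)\<^sup>2 \<le> 1"
      by (simp_all add: t_def divide_simps add_nonneg_pos)
    have "g > 0" using nz by (simp add: g_def)
    have "p + c *\<^sub>C s \<in> S" using S p that by (auto simp: csubspace_def)
    then have "norm (x - p) \<le> norm (x - p - c *\<^sub>C s)"
      using best by (simp add: diff_diff_eq)
    then have "(norm (x - p))\<^sup>2 \<le> (norm (x - p - c *\<^sub>C s))\<^sup>2"
      by (simp add: power_mono)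
    also have "\<dots> = (norm (x - p))\<^sup>2 - 2 * (t * g) + t\<^sup>2 * g * (norm s)\<^sup>2"
    proof -
      have "cnj c * cinner (x - p) s = of_real (t * g)"
        by (simp add: c_def g_def complex_norm_square mult.commute del: of_real_power)
      moreover have "(cmod c)\<^sup>2 = t\<^sup>2 * g"
        by (simp add: c_def g_def norm_mult power_mult_distrib)
      ultimately show ?thesis
        unfolding norm_diff_scaleC_sq by simp
    qed
    finally have "2 * (t * g) \<le> (t * g) * (t * (norm s)\<^sup>2)"
      by (simp add: power2_eq_square algebra_simps)
    also have "\<dots> \<le> (t * g) * 1"
      using \<open>t > 0\<close> \<open>g > 0\<close> \<open>t * (norm s)\<^sup>2 \<le> 1\<close> by (intro mult_left_mono) auto
    finally show False
      using \<open>t > 0\<close> \<open>g > 0\<close> by simp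
  qed
  then show ?thesis using p by blast
qed

lemma closed_csubspace_eq_UNIV:
  fixes S :: "'a::complex_hilbert set"
  assumes "csubspace S" "closed S"
    and "\<And>w. (\<And>s. s \<in> S \<Longrightarrow> cinner s w = 0) \<Longrightarrow> w = 0"
  shows "S = UNIV"
proof -
  have "x \<in> S" for x
  proof -
    obtain p where p: "p \<in> S" "\<And>s. s \<in> S \<Longrightarrow> cinner (x - p) s = 0"
      using orthogonal_projection_exists[OF assms(1,2), of x] by blast
    have "cinner s (x - p) = 0" if "s \<in> S" for s
      using p(2)[OF that] cinner_commute[of s "x - p"] by simp
    then show ?thesis using assms(3)[of "x - p"] p(1) by simp
  qed
  then show ?thesis by blast
qed

section \<open>Contractions\<close>

text \<open>Complex linearity is included so that the notion is preserved by strong limits as a whole; such a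
  limit will be the unitary group.\<close>

definition contraction :: "('a::complex_inner \<Rightarrow> 'a) \<Rightarrow> bool"
  where "contraction P \<longleftrightarrow> linear_operator UNIV P \<and> (\<forall>x. norm (P x) \<le> norm x)"

lemma contractionI:
  assumes "\<And>x y. P (x + y) = P x + P y" "\<And>c x. P (c *\<^sub>C x) = c *\<^sub>C P x"
    and "\<And>x. norm (P x) \<le> norm x"
  shows "contraction P"
  using assms by (simp add: contraction_def linear_operator_def csubspace_def)

lemma
  assumes "contraction P"
  shows contraction_add: "P (x + y) = P x + P y"
    and contraction_scaleC: "P (c *\<^sub>C x) = c *\<^sub>C P x"
    and contraction_norm: "norm (P x) \<le> norm x"
  using assms by (simp_all add: contraction_def linear_operator_def)

lemma contraction_scaleR:
  assumes "contraction P"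
  shows "P (r *\<^sub>R x) = r *\<^sub>R P x"
  using contraction_scaleC[OF assms, of "of_real r"] by (simp add: scaleC_of_real)

lemma contraction_diff:
  assumes "contraction P"
  shows "P (x - y) = P x - P y"
  using contraction_add[OF assms, of "x - y" y] by (simp add: algebra_simps)

lemma contraction_id: "contraction id"
  by (rule contractionI) simp_all

lemma contraction_comp:
  assumes "contraction P" "contraction Q"
  shows "contraction (\<lambda>x. P (Q x))"
  using assms
  by (intro contractionI) (auto simp: contraction_add contraction_scaleC intro: order_trans contraction_norm)

lemma contraction_funpow:
  assumes "contraction P"
  shows "contraction (P ^^ n)"
proof (induction n)
  case (Suc n)
  then show ?case
    using contraction_comp[OF assms Suc] by (simp add: comp_def)
qed (simp add: contraction_id[unfolded id_def])

lemma contraction_tendsto: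
  assumes "contraction P" "(f \<longlongrightarrow> l) F"
  shows "((\<lambda>n. P (f n)) \<longlongrightarrow> P l) F"
proof -
  have "bounded_linear P"
    by (rule bounded_linear_intro[of _ 1])
      (simp_all add: assms(1) contraction_add contraction_scaleR contraction_norm)
  then show ?thesis
    using assms(2) by (rule bounded_linear.tendsto)
qed

lemma contraction_limit:
  assumes P: "\<And>k. contraction (P k)" and lim: "\<And>x. (\<lambda>k. P k x) \<longlonglongrightarrow> T x"
  shows "contraction T"
proof (rule contractionI)
  fix x y c
  have "(\<lambda>k. P k (x + y)) \<longlonglongrightarrow> T x + T y"
    unfolding contraction_add[OF P] by (intro tendsto_add lim)
  then show "T (x + y) = T x + T y"
    using LIMSEQ_unique lim by blast
  have "(\<lambda>k. P k (c *\<^sub>C x)) \<longlonglongrightarrow> c *\<^sub>C T x"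
    unfolding contraction_scaleC[OF P] by (intro tendsto_scaleC lim)
  then show "T (c *\<^sub>C x) = c *\<^sub>C T x"
    using LIMSEQ_unique lim by blast
  show "norm (T x) \<le> norm x"
    by (rule LIMSEQ_le_const2[OF tendsto_norm[OF lim]]) (use contraction_norm[OF P] in blast)
qed

text \<open>Strong convergence needs to be checked on a dense set only: replacing x by a nearby z changes the
  difference by at most twice the distance, uniformly in h.\<close>

lemma contractions_diff_tendsto_dense:
  assumes P: "\<And>h. contraction (P h)" and Q: "\<And>h. contraction (Q h)"
    and dense: "closure S = UNIV"
    and lim: "\<And>x. x \<in> S \<Longrightarrow> ((\<lambda>h. P h x - Q h x) \<longlongrightarrow> 0) F"
  shows "((\<lambda>h. P h x - Q h x) \<longlongrightarrow> 0) F"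
proof (rule tendstoI)
  fix e :: real assume "e > 0"
  obtain z where z: "z \<in> S" "dist z x < e / 4"
    using dense closure_approachable[of x S] \<open>e > 0\<close> by (metis UNIV_I zero_less_divide_iff zero_less_numeral)
  have "\<forall>\<^sub>F h in F. dist (P h z - Q h z) 0 < e / 4"
    using lim[OF z(1)] by (rule tendstoD) (simp add: \<open>e > 0\<close>)
  then show "\<forall>\<^sub>F h in F. dist (P h x - Q h x) 0 < e"
  proof (rule eventually_mono)
    fix h assume h: "dist (P h z - Q h z) 0 < e / 4"
    have "P h x - Q h x = (P h z - Q h z) + (P h (x - z) - Q h (x - z))"
      by (simp add: contraction_diff[OF P] contraction_diff[OF Q])
    also have "norm \<dots> \<le> norm (P h z - Q h z) + (norm (P h (x - z)) + norm (Q h (x - z)))"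
      by (intro norm_triangle_mono norm_triangle_ineq4 order_refl)
    also have "\<dots> \<le> norm (P h z - Q h z) + (norm (x - z) + norm (x - z))"
      using contraction_norm[OF P] contraction_norm[OF Q] by (intro add_mono order_refl)
    also have "\<dots> < e"
      using h z(2) \<open>e > 0\<close> by (simp add: dist_norm norm_minus_commute)
    finally show "dist (P h x - Q h x) 0 < e" by simp
  qed
qed

lemma contractions_eq_dense:
  assumes "contraction P" "contraction Q" "closure S = UNIV" "\<And>x. x \<in> S \<Longrightarrow> P x = Q x"
  shows "P x = Q x"
proof -
  have "((\<lambda>_::nat. P x - Q x) \<longlongrightarrow> 0) sequentially"
    by (rule contractions_diff_tendsto_dense[OF assms(1-3)]) (simp add: assms(4))
  then show ?thesis by (simp add: LIMSEQ_const_iff)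
qed

lemma contractions_convergent_dense:
  fixes P :: "nat \<Rightarrow> 'a::complex_hilbert \<Rightarrow> 'a"
  assumes P: "\<And>k. contraction (P k)" and dense: "closure S = UNIV"
    and conv: "\<And>x. x \<in> S \<Longrightarrow> convergent (\<lambda>k. P k x)"
  shows "convergent (\<lambda>k. P k x)"
proof -
  have "Cauchy (\<lambda>k. P k x)"
  proof (rule CauchyI)
    fix e :: real assume "e > 0"
    obtain z where z: "z \<in> S" "dist z x < e / 4"
      using dense closure_approachable[of x S] \<open>e > 0\<close> by (metis UNIV_I zero_less_divide_iff zero_less_numeral)
    have near: "norm (P k x - P k z) < e / 4" for k
    proof -
      have "norm (P k x - P k z) \<le> norm (x - z)"
        using contraction_norm[OF P, of k "x - z"] by (simp add: contraction_diff[OF P])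
      then show ?thesis using z(2) by (simp add: dist_norm norm_minus_commute)
    qed
    have "Cauchy (\<lambda>k. P k z)" using conv[OF z(1)] by (rule convergent_Cauchy)
    then obtain M where M: "\<And>m n. m \<ge> M \<Longrightarrow> n \<ge> M \<Longrightarrow> norm (P m z - P n z) < e / 4"
      unfolding Cauchy_iff using \<open>e > 0\<close> by (meson zero_less_divide_iff zero_less_numeral)
    have "norm (P m x - P n x) < e" if "m \<ge> M" "n \<ge> M" for m n
    proof -
      have "P m x - P n x = (P m x - P m z) + ((P m z - P n z) - (P n x - P n z))" by simp
      also have "norm \<dots> \<le> norm (P m x - P m z) + (norm (P m z - P n z) + norm (P n x - P n z))"
        by (intro norm_triangle_mono norm_triangle_ineq4 order_refl)
      also have "\<dots> < e"
        using near[of m] near[of n] M[OF that] \<open>e > 0\<close> by linarith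
      finally show ?thesis .
    qed
    then show "\<exists>M. \<forall>m\<ge>M. \<forall>n\<ge>M. norm (P m x - P n x) < e" by blast
  qed
  then show ?thesis by (rule Cauchy_convergent)
qed

text \<open>This is how local errors turn into global ones. The difference telescopes into n terms, each of
  which is a product of n - 1 contractions applied to P x - Q x, because P and Q commute. A one-step
  error of order o(1 / n) is therefore harmless over n steps.\<close>

lemma contraction_power_diff:
  assumes P: "contraction P" and Q: "contraction Q" and comm: "\<And>x. P (Q x) = Q (P x)"
  shows "norm ((P ^^ n) x - (Q ^^ n) x) \<le> real n * norm (P x - Q x)"
proof (induction n)
  case (Suc n)
  have PnQ: "(P ^^ n) (Q x) = Q ((P ^^ n) x)"
    by (induction n) (simp_all add: comm)
  have "(P ^^ Suc n) x - (Q ^^ Suc n) x = (P ^^ n) (P x - Q x) + Q ((P ^^ n) x - (Q ^^ n) x)"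
    by (simp add: contraction_diff[OF contraction_funpow[OF P]] contraction_diff[OF Q] PnQ
        funpow_swap1)
  also have "norm \<dots> \<le> norm (P x - Q x) + norm ((P ^^ n) x - (Q ^^ n) x)"
    by (intro norm_triangle_mono contraction_norm contraction_funpow P Q)
  also have "\<dots> \<le> real (Suc n) * norm (P x - Q x)"
    using Suc by (simp add: algebra_simps)
  finally show ?case .
qed simp

lemma funpow_comp_commuting:
  assumes "\<And>x. P (Q x) = Q (P x)"
  shows "((\<lambda>x. P (Q x)) ^^ n) x = (P ^^ n) ((Q ^^ n) x)"
proof (induction n)
  case (Suc n)
  have "(P ^^ n) (Q y) = Q ((P ^^ n) y)" for y
    by (induction n) (simp_all add: assms)
  then show ?case using Suc by simp
qed simp

lemma contractions_tendsto_comp: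
  fixes P :: "nat \<Rightarrow> 'a::complex_inner \<Rightarrow> 'a"
  assumes P: "\<And>k. contraction (P k)" and "(\<lambda>k. P k y) \<longlonglongrightarrow> z" and "f \<longlonglongrightarrow> y"
  shows "(\<lambda>k. P k (f k)) \<longlonglongrightarrow> z"
proof -
  have "(\<lambda>k. norm (f k - y)) \<longlonglongrightarrow> 0"
    using assms(3) by (intro tendsto_norm_zero LIM_zero)
  then have "(\<lambda>k. P k (f k - y)) \<longlonglongrightarrow> 0"
    by (rule Lim_null_comparison[rotated]) (intro always_eventually allI contraction_norm P)
  from tendsto_add[OF this assms(2)] show ?thesis
    by (simp add: contraction_diff[OF P])
qed

text \<open>By polarization, the inner product is determined by the norm.\<close>

lemma isometry_cinner:
  assumes "contraction P" and iso: "\<And>x. norm (P x) = norm x"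
  shows "cinner (P x) (P y) = cinner x y"
proof -
  have Re: "Re (cinner (P x) (P y)) = Re (cinner x y)" for x y
    using norm_add_sq[of x y] norm_add_sq[of "P x" "P y"] iso[of "x + y"]
    by (simp add: contraction_add[OF assms(1)] iso)
  have "Im (cinner (P x) (P y)) = Im (cinner x y)"
    using Re[of x "\<i> *\<^sub>C y"] by (simp add: contraction_scaleC[OF assms(1)] cinner_scaleC_right)
  with Re show ?thesis by (simp add: complex_eq_iff)
qed

section \<open>Unitary groups and their generators\<close>

lemma generatesD:
  assumes "generates D B U"
  shows "x \<in> D \<Longrightarrow> ((\<lambda>h. (U h x - x) /\<^sub>R h) \<longlongrightarrow> B x) (at 0)"
    and "((\<lambda>h. (U h x - x) /\<^sub>R h) \<longlongrightarrow> z) (at 0) \<Longrightarrow> x \<in> D"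
    and "((\<lambda>h. (U h x - x) /\<^sub>R h) \<longlongrightarrow> z) (at 0) \<Longrightarrow> z = B x"
  using assms unfolding generates_def by blast+

lemma unitary_group_zero: "unitary_group U \<Longrightarrow> U 0 x = x"
  by (simp add: unitary_group_def)

lemma unitary_group_add: "unitary_group U \<Longrightarrow> U (s + t) x = U s (U t x)"
  by (simp add: unitary_group_def)

lemma unitary_group_continuous: "unitary_group U \<Longrightarrow> continuous_on UNIV (\<lambda>t. U t x)"
  by (simp add: unitary_group_def)

lemma unitary_group_norm:
  assumes "unitary_group U"
  shows "norm (U t x) = norm x"
proof -
  have "cinner (U t x) (U t x) = cinner x x"
    using assms by (simp only: unitary_group_def unitary_def)
  then have "(norm (U t x))\<^sup>2 = (norm x)\<^sup>2"
    by (simp only: norm_sq_eq_cinner)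
  then show ?thesis by simp
qed

lemma unitary_group_contraction: "unitary_group U \<Longrightarrow> contraction (U t)"
  using unitary_group_norm[of U t] by (simp add: contraction_def unitary_group_def unitary_def)

lemma unitary_group_mult: "unitary_group U \<Longrightarrow> U (real n * s) x = (U s ^^ n) x"
  by (induction n) (simp_all add: unitary_group_zero unitary_group_add algebra_simps)

lemma unitary_group_quotient:
  assumes U: "unitary_group U"
  shows "(U h (U t x) - U t x) /\<^sub>R h = U t ((U h x - x) /\<^sub>R h)"
proof -
  note C = unitary_group_contraction[OF U]
  have "U h (U t x) = U t (U h x)"
    using unitary_group_add[OF U, of h t x] unitary_group_add[OF U, of t h x] by (simp add: add.commute)
  then show ?thesis
    by (simp add: contraction_scaleR[OF C] contraction_diff[OF C])
qed

text \<open>The difference quotient of the orbit at U t x is the image of the difference quotient at x, so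
  it converges; the generator's domain consists of all points where this happens.\<close>

lemma generator_commutes:
  assumes U: "unitary_group U" and gen: "generates D B U" and "x \<in> D"
  shows "U t x \<in> D" and "B (U t x) = U t (B x)"
proof -
  have "((\<lambda>h. U t ((U h x - x) /\<^sub>R h)) \<longlongrightarrow> U t (B x)) (at 0)"
    by (rule contraction_tendsto[OF unitary_group_contraction[OF U] generatesD(1)[OF gen assms(3)]])
  then have *: "((\<lambda>h. (U h (U t x) - U t x) /\<^sub>R h) \<longlongrightarrow> U t (B x)) (at 0)"
    by (simp only: unitary_group_quotient[OF U])
  show "U t x \<in> D" by (rule generatesD(2)[OF gen *])
  show "B (U t x) = U t (B x)" by (rule generatesD(3)[OF gen *, symmetric])
qed

section \<open>Selfadjoint operators and their resolvents\<close>

locale selfadjoint_operator =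
  fixes D :: "'a::complex_hilbert set" and A :: "'a \<Rightarrow> 'a"
  assumes selfadjoint: "selfadjoint D A"
begin

definition iA :: "'a \<Rightarrow> 'a"
  where "iA x = \<i> *\<^sub>C A x"

lemma csubspace_domain: "csubspace D"
  and A_add: "x \<in> D \<Longrightarrow> y \<in> D \<Longrightarrow> A (x + y) = A x + A y"
  and A_scaleC: "x \<in> D \<Longrightarrow> A (c *\<^sub>C x) = c *\<^sub>C A x"
  and domain_dense: "closure D = UNIV"
  using selfadjoint by (auto simp: selfadjoint_def linear_operator_def)

lemma adjoint_domain_eq: "adjoint_domain D A = D"
  and adjoint_op_eq: "x \<in> D \<Longrightarrow> adjoint_op D A x = A x"
  using selfadjoint by (simp_all add: selfadjoint_def)

lemma domain_zero: "0 \<in> D"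
  and domain_add: "x \<in> D \<Longrightarrow> y \<in> D \<Longrightarrow> x + y \<in> D"
  and domain_scaleC: "x \<in> D \<Longrightarrow> c *\<^sub>C x \<in> D"
  using csubspace_domain by (auto simp: csubspace_def)

lemmas domain_diff = csubspace_diff[OF csubspace_domain]

lemma A_diff: "x \<in> D \<Longrightarrow> y \<in> D \<Longrightarrow> A (x - y) = A x - A y"
  using A_add[of "x - y" y] domain_diff[of x y] by (simp add: algebra_simps)

lemma iA_add: "x \<in> D \<Longrightarrow> y \<in> D \<Longrightarrow> iA (x + y) = iA x + iA y"
  by (simp add: iA_def A_add scaleC_add_right)

lemma iA_diff: "x \<in> D \<Longrightarrow> y \<in> D \<Longrightarrow> iA (x - y) = iA x - iA y"
  by (simp add: iA_def A_diff scaleC_diff_right)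

lemma iA_scaleC: "x \<in> D \<Longrightarrow> iA (c *\<^sub>C x) = c *\<^sub>C iA x"
  by (simp add: iA_def A_scaleC scaleC_scaleC mult.commute)

lemma iA_zero: "iA 0 = 0"
  using iA_scaleC[OF domain_zero, of 0] by simp

lemma dense_cinner_eq:
  assumes "\<And>x. x \<in> D \<Longrightarrow> cinner x z = cinner x w"
  shows "z = w"
proof -
  obtain f where f: "\<And>n. f n \<in> D" "f \<longlonglongrightarrow> z - w"
    using domain_dense closure_sequential[of "z - w" D] by auto
  have "(\<lambda>n. cinner (f n) (z - w)) \<longlonglongrightarrow> cinner (z - w) (z - w)"
    by (intro tendsto_cinner f tendsto_const)
  moreover have "cinner (f n) (z - w) = 0" for n
    using assms[OF f(1)] by (simp add: cinner_diff_right)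
  ultimately have "cinner (z - w) (z - w) = 0"
    by (simp add: LIMSEQ_const_iff)
  then show ?thesis by (simp add: cinner_self)
qed

text \<open>A selfadjoint operator has no proper symmetric extension: satisfying the equation A y = z in the
  weak sense already puts y into the domain. The closedness of the graph, the existence of the
  resolvents, the identification of the generator and the description of the null space as the
  orthogonal complement of the range all rest on this.\<close>

lemma in_domainI:
  assumes "\<And>x. x \<in> D \<Longrightarrow> cinner (A x) y = cinner x z"
  shows "y \<in> D" and "A y = z"
proof -
  have "y \<in> adjoint_domain D A"
    using assms by (auto simp: adjoint_domain_def)
  then show "y \<in> D"
    by (simp add: adjoint_domain_eq)
  then have "A y = adjoint_op D A y"
    by (simp add: adjoint_op_eq)
  also have "\<dots> = z"
    unfolding adjoint_op_def
  proof (rule the_equality)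
    fix w assume "\<forall>x\<in>D. cinner (A x) y = cinner x w"
    then show "w = z" using assms by (intro dense_cinner_eq) metis
  qed (use assms in blast)
  finally show "A y = z" .
qed

lemma A_symmetric:
  assumes "x \<in> D" "y \<in> D"
  shows "cinner (A x) y = cinner x (A y)"
proof -
  have "y \<in> adjoint_domain D A"
    using assms(2) by (simp add: adjoint_domain_eq)
  then obtain z where z: "\<And>x. x \<in> D \<Longrightarrow> cinner (A x) y = cinner x z"
    by (auto simp: adjoint_domain_def)
  then have "A y = z" by (rule in_domainI(2))
  then show ?thesis using z assms(1) by simp
qed

lemma iA_skew:
  assumes "x \<in> D" "y \<in> D"
  shows "cinner (iA x) y = - cinner x (iA y)"
  using A_symmetric[OF assms] by (simp add: iA_def cinner_scaleC_left cinner_scaleC_right)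

lemma iA_graph_closed:
  assumes "\<And>n::nat. u n \<in> D" "u \<longlonglongrightarrow> y" "(\<lambda>n. iA (u n)) \<longlonglongrightarrow> z"
  shows "y \<in> D" and "iA y = z"
proof -
  have adj: "cinner (A x) y = cinner x ((- \<i>) *\<^sub>C z)" if "x \<in> D" for x
  proof -
    have "(\<lambda>n. (- \<i>) *\<^sub>C iA (u n)) \<longlonglongrightarrow> (- \<i>) *\<^sub>C z"
      by (intro tendsto_scaleC assms)
    then have "(\<lambda>n. cinner x (A (u n))) \<longlonglongrightarrow> cinner x ((- \<i>) *\<^sub>C z)"
      by (intro tendsto_cinner tendsto_const) (simp add: iA_def scaleC_scaleC)
    moreover have "(\<lambda>n. cinner (A x) (u n)) \<longlonglongrightarrow> cinner (A x) y"
      by (intro tendsto_cinner tendsto_const assms)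
    ultimately show ?thesis
      using A_symmetric[OF that assms(1)] LIMSEQ_unique by simp
  qed
  show "y \<in> D" by (rule in_domainI(1)[OF adj])
  have "A y = (- \<i>) *\<^sub>C z" by (rule in_domainI(2)[OF adj])
  then show "iA y = z" by (simp add: iA_def scaleC_scaleC)
qed

text \<open>Since i A is skew, x and i A x are orthogonal in the real sense, so Pythagoras applies. This makes
  1 - h i A injective with a contractive inverse, for h of either sign.\<close>

lemma norm_resolvent_eq:
  assumes "x \<in> D"
  shows "(norm (x - h *\<^sub>R iA x))\<^sup>2 = (norm x)\<^sup>2 + h\<^sup>2 * (norm (iA x))\<^sup>2"
proof -
  have "Re (cinner x (iA x)) = 0"
    using iA_skew[OF assms assms] cinner_commute[of "iA x" x]
    by (metis add.inverse_neutral cnj.simps(1) equation_minus_iff neg_equal_zero uminus_complex.simps(1))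
  then show ?thesis
    using norm_add_sq[of x "- (h *\<^sub>R iA x)"]
    by (simp add: cinner_minus_right cinner_scaleR_right power_mult_distrib)
qed

lemma norm_resolvent_le:
  assumes "x \<in> D"
  shows "norm x \<le> norm (x - h *\<^sub>R iA x)"
  using norm_resolvent_eq[OF assms, of h] by - (rule power2_le_imp_le, simp_all)

lemma resolvent_inj: "inj_on (\<lambda>x. x - h *\<^sub>R iA x) D"
proof (rule inj_onI)
  fix x y assume "x \<in> D" "y \<in> D" "x - h *\<^sub>R iA x = y - h *\<^sub>R iA y"
  then have "(x - y) - h *\<^sub>R iA (x - y) = 0"
    by (simp add: iA_diff algebra_simps)
  then show "x = y"
    using norm_resolvent_le[OF domain_diff[OF \<open>x \<in> D\<close> \<open>y \<in> D\<close>], of h] by simp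
qed

text \<open>Injectivity with a contractive inverse makes preimages of Cauchy sequences Cauchy, and the graph is
  closed.\<close>

lemma resolvent_range_closed:
  assumes "h \<noteq> 0"
  shows "closed ((\<lambda>x. x - h *\<^sub>R iA x) ` D)"
  unfolding closed_sequential_limits
proof (intro allI impI, elim conjE)
  fix g z assume "\<forall>n::nat. g n \<in> (\<lambda>x. x - h *\<^sub>R iA x) ` D" and g: "g \<longlonglongrightarrow> z"
  then have "\<forall>n. \<exists>x. x \<in> D \<and> g n = x - h *\<^sub>R iA x"
    by blast
  from choice[OF this] obtain u where u: "\<And>n. u n \<in> D" "\<And>n. g n = u n - h *\<^sub>R iA (u n)"
    by blast
  have diff: "norm (u m - u n) \<le> norm (g m - g n)" for m n
  proof -
    have "g m - g n = (u m - u n) - h *\<^sub>R iA (u m - u n)"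
      by (simp add: u iA_diff algebra_simps)
    then show ?thesis
      using norm_resolvent_le[OF domain_diff[OF u(1) u(1)]] by simp
  qed
  have "Cauchy u"
    using LIMSEQ_imp_Cauchy[OF g] diff unfolding Cauchy_iff by (meson le_less_trans)
  then obtain y where y: "u \<longlonglongrightarrow> y"
    using Cauchy_convergent convergent_def by blast
  have "(\<lambda>n. (1 / h) *\<^sub>R (u n - g n)) \<longlonglongrightarrow> (1 / h) *\<^sub>R (y - z)"
    by (intro tendsto_intros y g)
  then have lim: "(\<lambda>n. iA (u n)) \<longlonglongrightarrow> (1 / h) *\<^sub>R (y - z)"
    using assms by (simp add: u(2))
  have "z = y - h *\<^sub>R iA y"
    using iA_graph_closed(2)[OF u(1) y lim] assms by simp
  then show "z \<in> (\<lambda>x. x - h *\<^sub>R iA x) ` D"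
    by (rule image_eqI) (rule iA_graph_closed(1)[OF u(1) y lim])
qed

lemma resolvent_range_csubspace: "csubspace ((\<lambda>x. x - h *\<^sub>R iA x) ` D)"
  unfolding csubspace_def
proof (intro conjI ballI allI)
  show "0 \<in> (\<lambda>x. x - h *\<^sub>R iA x) ` D"
    by (rule image_eqI[of _ _ 0]) (simp_all add: domain_zero iA_zero)
next
  fix v w assume "v \<in> (\<lambda>x. x - h *\<^sub>R iA x) ` D" "w \<in> (\<lambda>x. x - h *\<^sub>R iA x) ` D"
  then obtain x y where "x \<in> D" "y \<in> D" "v = x - h *\<^sub>R iA x" "w = y - h *\<^sub>R iA y"
    by auto
  then show "v + w \<in> (\<lambda>x. x - h *\<^sub>R iA x) ` D"
    by - (rule image_eqI[of _ _ "x + y"], simp_all add: iA_add domain_add scaleR_add_right)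
next
  fix c v assume "v \<in> (\<lambda>x. x - h *\<^sub>R iA x) ` D"
  then obtain x where "x \<in> D" "v = x - h *\<^sub>R iA x"
    by auto
  then show "c *\<^sub>C v \<in> (\<lambda>x. x - h *\<^sub>R iA x) ` D"
    by - (rule image_eqI[of _ _ "c *\<^sub>C x"],
      simp_all add: iA_scaleC domain_scaleC scaleC_diff_right scaleC_scaleR)
qed

text \<open>A vector w orthogonal to the range is, weakly and hence strongly, a solution of w + h i A w = 0, and
  the injectivity of 1 + h i A forces w = 0.\<close>

lemma resolvent_surj:
  assumes "h \<noteq> 0"
  shows "(\<lambda>x. x - h *\<^sub>R iA x) ` D = UNIV"
proof (rule closed_csubspace_eq_UNIV[OF resolvent_range_csubspace resolvent_range_closed[OF assms]])
  fix w assume orth: "\<And>s. s \<in> (\<lambda>x. x - h *\<^sub>R iA x) ` D \<Longrightarrow> cinner s w = 0"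
  have adj: "cinner (A x) w = cinner x ((\<i> / of_real h) *\<^sub>C w)" if "x \<in> D" for x
  proof -
    have "cinner x w = of_real h * (\<i> * cinner (A x) w)"
      using orth[of "x - h *\<^sub>R iA x"] that
      by (simp add: cinner_diff_left cinner_scaleR_left iA_def cinner_scaleC_left)
    then show ?thesis
      using assms by (simp add: cinner_scaleC_right field_simps)
  qed
  have w: "w \<in> D" by (rule in_domainI(1)[OF adj])
  have "A w = (\<i> / of_real h) *\<^sub>C w" by (rule in_domainI(2)[OF adj])
  then have "h *\<^sub>R iA w = - w"
    using assms by (simp add: iA_def scaleC_scaleC scaleC_minus_one flip: scaleC_of_real)
  then show "w = 0"
    using norm_resolvent_le[OF w, of "- h"] by simp
qed

text \<open>The implicit Euler step (1 - h i A)^{-1}. For h = 0 the operator inverted is the identity on the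
  domain only, so its extension to the whole space is put in by hand; Euler steps of length 0 and of
  negative length then need no separate treatment.\<close>

definition resolvent :: "real \<Rightarrow> 'a \<Rightarrow> 'a"
  where "resolvent h x = (if h = 0 then x else inv_into D (\<lambda>x. x - h *\<^sub>R iA x) x)"

lemma resolvent_zero [simp]: "resolvent 0 x = x"
  by (simp add: resolvent_def)

lemma resolvent_in_domain:
  assumes "h \<noteq> 0 \<or> x \<in> D"
  shows "resolvent h x \<in> D"
proof (cases "h = 0")
  case False
  then have "x \<in> (\<lambda>x. x - h *\<^sub>R iA x) ` D"
    by (simp only: resolvent_surj UNIV_I not_False_eq_True)
  from inv_into_into[OF this] show ?thesis
    by (simp only: resolvent_def False if_False)
qed (use assms in simp)

lemma resolvent_right: "resolvent h x - h *\<^sub>R iA (resolvent h x) = x"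
proof (cases "h = 0")
  case False
  then have "x \<in> (\<lambda>x. x - h *\<^sub>R iA x) ` D"
    by (simp only: resolvent_surj UNIV_I not_False_eq_True)
  from f_inv_into_f[OF this] show ?thesis
    by (simp only: resolvent_def False if_False)
qed simp

lemma resolvent_left: "x \<in> D \<Longrightarrow> resolvent h (x - h *\<^sub>R iA x) = x"
  using inv_into_f_f[OF resolvent_inj, of x h] by (simp add: resolvent_def)

lemma resolvent_eqI:
  assumes "u \<in> D" "u - h *\<^sub>R iA u = x"
  shows "resolvent h x = u"
  using resolvent_left[OF assms(1), of h] assms(2) by simp

lemma contraction_resolvent: "contraction (resolvent h)"
proof (cases "h = 0")
  case True
  then have "resolvent h = id" by (simp add: fun_eq_iff)
  then show ?thesis by (simp add: contraction_id)
next
  case False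
  note dom = resolvent_in_domain[OF disjI1, OF False]
  show ?thesis
  proof (rule contractionI)
    fix x y c
    have "(resolvent h x + resolvent h y) - h *\<^sub>R iA (resolvent h x + resolvent h y)
        = (resolvent h x - h *\<^sub>R iA (resolvent h x)) + (resolvent h y - h *\<^sub>R iA (resolvent h y))"
      by (simp add: iA_add dom scaleR_add_right)
    also have "\<dots> = x + y"
      by (simp only: resolvent_right)
    finally show "resolvent h (x + y) = resolvent h x + resolvent h y"
      by (rule resolvent_eqI[OF domain_add[OF dom dom]])
    have "c *\<^sub>C resolvent h x - h *\<^sub>R iA (c *\<^sub>C resolvent h x)
        = c *\<^sub>C (resolvent h x - h *\<^sub>R iA (resolvent h x))"
      by (simp add: iA_scaleC dom scaleC_scaleR scaleC_diff_right)
    also have "\<dots> = c *\<^sub>C x"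
      by (simp only: resolvent_right)
    finally show "resolvent h (c *\<^sub>C x) = c *\<^sub>C resolvent h x"
      by (rule resolvent_eqI[OF domain_scaleC[OF dom]])
    show "norm (resolvent h x) \<le> norm x"
      using norm_resolvent_le[OF dom, of x h] by (simp add: resolvent_right)
  qed
qed

lemma resolvent_taylor1:
  assumes "x \<in> D"
  shows "resolvent h x = x + h *\<^sub>R resolvent h (iA x)"
  using resolvent_left[OF assms, of h]
  by (simp add: contraction_diff[OF contraction_resolvent] contraction_scaleR[OF contraction_resolvent]
      algebra_simps)

lemma resolvent_commutes:
  assumes "x \<in> D"
  shows "iA (resolvent h x) = resolvent h (iA x)"
proof (cases "h = 0")
  case False
  have "h *\<^sub>R iA (resolvent h x) = resolvent h x - x"
    using resolvent_right[of h x] by (simp add: algebra_simps)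
  also have "\<dots> = h *\<^sub>R resolvent h (iA x)"
    using resolvent_taylor1[OF assms, of h] by simp
  finally show ?thesis using False by simp
qed simp

text \<open>Stated for arbitrary P, since it serves twice: for two resolvents, and for comparing the group
  constructed below with a competing group that has the same generator.\<close>

lemma commutes_with_resolvent:
  assumes P: "contraction P" and dom: "\<And>x. x \<in> D \<Longrightarrow> P x \<in> D"
    and comm: "\<And>x. x \<in> D \<Longrightarrow> iA (P x) = P (iA x)"
  shows "P (resolvent h x) = resolvent h (P x)"
proof (cases "h = 0")
  case False
  note D = resolvent_in_domain[OF disjI1, OF False]
  have "P (resolvent h x) - h *\<^sub>R iA (P (resolvent h x)) = P (resolvent h x - h *\<^sub>R iA (resolvent h x))"
    by (simp add: comm D contraction_diff[OF P] contraction_scaleR[OF P])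
  also have "\<dots> = P x"
    by (simp only: resolvent_right)
  finally show ?thesis
    using resolvent_eqI[OF dom[OF D]] by metis
qed simp

lemma resolvents_commute: "resolvent g (resolvent h x) = resolvent h (resolvent g x)"
  by (rule commutes_with_resolvent)
    (simp_all add: contraction_resolvent resolvent_in_domain resolvent_commutes)

text \<open>The domain of A^2, where Euler steps are accurate to second order.\<close>

definition D2 :: "'a set"
  where "D2 = {x \<in> D. iA x \<in> D}"

lemma resolvent_taylor2:
  assumes "x \<in> D2"
  shows "resolvent h x = x + h *\<^sub>R iA x + h\<^sup>2 *\<^sub>R resolvent h (iA (iA x))"
  using assms resolvent_taylor1[of x h] resolvent_taylor1[of "iA x" h]
  by (simp add: D2_def power2_eq_square scaleR_add_right)

lemma resolvent_minus_id:
  assumes "x \<in> D"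
  shows "norm (resolvent h x - x) \<le> \<bar>h\<bar> * norm (iA x)"
  using resolvent_taylor1[OF assms, of h] contraction_norm[OF contraction_resolvent, of h "iA x"]
  by (simp add: mult_left_mono)

text \<open>One Euler step of length g + h agrees with two steps of lengths g and h up to second order, as both
  have the expansion x + (g + h) i A x + O((|g| + |h|)^2). With g = h it measures the effect of halving
  the step size, with arbitrary g and h the defect in the group law.\<close>

lemma resolvent_add_error:
  assumes "x \<in> D2"
  shows "norm (resolvent (g + h) x - resolvent g (resolvent h x))
    \<le> 2 * (\<bar>g\<bar> + \<bar>h\<bar>)\<^sup>2 * norm (iA (iA x))"
proof -
  let ?b = "iA (iA x)" and ?M = "norm (iA (iA x))"
  note R = contraction_resolvent
  have x: "x \<in> D" "iA x \<in> D" using assms by (auto simp: D2_def)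
  have "resolvent g (resolvent h x)
      = resolvent g x + h *\<^sub>R resolvent g (iA x) + h\<^sup>2 *\<^sub>R resolvent g (resolvent h ?b)"
    unfolding resolvent_taylor2[OF assms, of h]
    by (simp add: contraction_add[OF R] contraction_scaleR[OF R])
  also have "\<dots> = x + (g + h) *\<^sub>R iA x + g\<^sup>2 *\<^sub>R resolvent g ?b + (h * g) *\<^sub>R resolvent g ?b
      + h\<^sup>2 *\<^sub>R resolvent g (resolvent h ?b)"
    unfolding resolvent_taylor2[OF assms, of g] resolvent_taylor1[OF x(2), of g]
    by (simp add: algebra_simps)
  finally have expand: "resolvent (g + h) x - resolvent g (resolvent h x)
      = (g + h)\<^sup>2 *\<^sub>R resolvent (g + h) ?b - (g\<^sup>2 *\<^sub>R resolvent g ?b + (h * g) *\<^sub>R resolvent g ?b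
        + h\<^sup>2 *\<^sub>R resolvent g (resolvent h ?b))"
    unfolding resolvent_taylor2[OF assms, of "g + h"] by simp
  have "norm (resolvent (g + h) x - resolvent g (resolvent h x))
      \<le> (g + h)\<^sup>2 * ?M + (g\<^sup>2 * ?M + \<bar>h * g\<bar> * ?M + h\<^sup>2 * ?M)"
  proof -
    have n1: "norm (c *\<^sub>R resolvent k ?b) \<le> \<bar>c\<bar> * ?M" for c k
      by (simp add: mult_left_mono contraction_norm[OF R])
    have n2: "norm (c *\<^sub>R resolvent k (resolvent l ?b)) \<le> \<bar>c\<bar> * ?M" for c k l
      using contraction_norm[OF contraction_comp[OF R R], of k l ?b] by (simp add: mult_left_mono)
    have triangle: "norm (p - (q + r + s)) \<le> norm p + (norm q + norm r + norm s)" for p q r s :: 'a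
      using norm_triangle_ineq4[of p "q + r + s"] norm_triangle_ineq[of "q + r" s] norm_triangle_ineq[of q r]
      by linarith
    show ?thesis
      unfolding expand
      by (rule order_trans[OF triangle])
        (intro add_mono n1[of "(g + h)\<^sup>2", unfolded abs_power2] n1[of "g\<^sup>2", unfolded abs_power2]
          n1[of "h * g"] n2[of "h\<^sup>2", unfolded abs_power2])
  qed
  also have "\<dots> = ((g + h)\<^sup>2 + g\<^sup>2 + \<bar>h * g\<bar> + h\<^sup>2) * ?M"
    by (simp only: distrib_right add.assoc)
  also have "\<dots> \<le> 2 * (\<bar>g\<bar> + \<bar>h\<bar>)\<^sup>2 * ?M"
  proof (rule mult_right_mono)
    have "(g + h)\<^sup>2 \<le> (\<bar>g\<bar> + \<bar>h\<bar>)\<^sup>2"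
      using abs_triangle_ineq[of g h] by (intro abs_le_square_iff[THEN iffD1]) simp
    moreover have "g\<^sup>2 + \<bar>h * g\<bar> + h\<^sup>2 \<le> (\<bar>g\<bar> + \<bar>h\<bar>)\<^sup>2"
      using zero_le_mult_iff[of "\<bar>h\<bar>" "\<bar>g\<bar>"] by (simp add: power2_sum abs_mult mult.commute)
    ultimately show "(g + h)\<^sup>2 + g\<^sup>2 + \<bar>h * g\<bar> + h\<^sup>2 \<le> 2 * (\<bar>g\<bar> + \<bar>h\<bar>)\<^sup>2"
      by linarith
  qed simp
  finally show ?thesis .
qed

lemma resolvent_tendsto:
  assumes "(h \<longlongrightarrow> 0) F"
  shows "((\<lambda>n. resolvent (h n) x) \<longlongrightarrow> x) F"
proof -
  have "((\<lambda>n. resolvent (h n) x - id x) \<longlongrightarrow> 0) F"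
  proof (rule contractions_diff_tendsto_dense[OF contraction_resolvent contraction_id domain_dense])
    fix x assume "x \<in> D"
    have "((\<lambda>n. \<bar>h n\<bar> * norm (iA x)) \<longlongrightarrow> 0) F"
      using assms by (intro tendsto_eq_intros) auto
    then show "((\<lambda>n. resolvent (h n) x - id x) \<longlongrightarrow> 0) F"
      using resolvent_minus_id[OF \<open>x \<in> D\<close>]
      by - (rule Lim_null_comparison[of _ "\<lambda>n. \<bar>h n\<bar> * norm (iA x)"], auto)
  qed
  then show ?thesis by (simp add: LIM_zero_cancel)
qed

text \<open>Each resolvent gains one order of regularity; two of them reach the domain of A^2.\<close>

definition mollify :: "nat \<Rightarrow> 'a \<Rightarrow> 'a"
  where "mollify n x = resolvent (1 / real (Suc n)) (resolvent (1 / real (Suc n)) x)"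

lemma mollify_commutes: "x \<in> D \<Longrightarrow> iA (mollify n x) = mollify n (iA x)"
  by (simp add: mollify_def resolvent_commutes resolvent_in_domain)

lemma mollify_in_D2: "mollify n x \<in> D2"
  by (simp add: D2_def mollify_def resolvent_in_domain resolvent_commutes del: of_nat_Suc)

lemma mollify_tendsto: "(\<lambda>n. mollify n x) \<longlonglongrightarrow> x"
proof -
  let ?R = "\<lambda>n. resolvent (1 / real (Suc n))"
  have R: "(\<lambda>n. ?R n x) \<longlonglongrightarrow> x" for x
    using LIMSEQ_inverse_real_of_nat by - (rule resolvent_tendsto, simp add: inverse_eq_divide)
  have "(\<lambda>n. norm (?R n x - x)) \<longlonglongrightarrow> 0"
    using tendsto_norm[OF LIM_zero[OF R[of x]]] by simp
  then have "(\<lambda>n. ?R n (?R n x - x)) \<longlonglongrightarrow> 0"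
    by (rule Lim_null_comparison[rotated])
      (intro always_eventually allI contraction_norm contraction_resolvent)
  from tendsto_add[OF this R[of x]] show ?thesis
    by (simp add: mollify_def contraction_diff[OF contraction_resolvent])
qed

lemma D2_dense: "closure D2 = UNIV"
proof -
  have "x \<in> closure D2" for x
    unfolding closure_sequential
    using mollify_in_D2 mollify_tendsto by (intro exI[of _ "\<lambda>n. mollify n x"]) simp
  then show ?thesis by blast
qed

section \<open>The unitary group as a limit of implicit Euler steps\<close>

text \<open>Dyadic step numbers make each approximation a refinement of the preceding one, so that consecutive
  approximations can be compared by halving every step.\<close>

definition euler :: "nat \<Rightarrow> real \<Rightarrow> 'a \<Rightarrow> 'a"
  where "euler k t = resolvent (t / 2 ^ k) ^^ (2 ^ k)"

lemma contraction_euler: "contraction (euler k t)"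
  unfolding euler_def by (intro contraction_funpow contraction_resolvent)

lemma euler_step:
  assumes "x \<in> D2"
  shows "norm (euler (Suc k) t x - euler k t x) \<le> 2 * t\<^sup>2 * norm (iA (iA x)) * (1 / 2) ^ k"
proof -
  define h where "h = t / 2 ^ Suc k"
  have hh: "h + h = t / 2 ^ k" by (simp add: h_def)
  have 1: "euler k t = resolvent (h + h) ^^ (2 ^ k)"
    by (simp add: euler_def hh)
  have "euler (Suc k) t = (resolvent h ^^ 2) ^^ (2 ^ k)"
    by (simp add: euler_def h_def funpow_mult)
  also have "resolvent h ^^ 2 = (\<lambda>x. resolvent h (resolvent h x))"
    by (simp add: fun_eq_iff numeral_2_eq_2)
  finally have 2: "euler (Suc k) t = (\<lambda>x. resolvent h (resolvent h x)) ^^ (2 ^ k)" .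
  have "norm (euler (Suc k) t x - euler k t x) = norm (euler k t x - euler (Suc k) t x)"
    by (rule norm_minus_commute)
  also have "\<dots> \<le> real (2 ^ k) * norm (resolvent (h + h) x - resolvent h (resolvent h x))"
    unfolding 1 2
    by (rule contraction_power_diff) (simp_all add: contraction_resolvent contraction_comp resolvents_commute)
  also have "\<dots> \<le> real (2 ^ k) * (2 * (\<bar>h\<bar> + \<bar>h\<bar>)\<^sup>2 * norm (iA (iA x)))"
    by (intro mult_left_mono resolvent_add_error assms) simp
  also have "(\<bar>h\<bar> + \<bar>h\<bar>)\<^sup>2 = t\<^sup>2 / (2 ^ k)\<^sup>2"
    using hh by (simp add: h_def power_divide)
  also have "real (2 ^ k) * (2 * (t\<^sup>2 / (2 ^ k)\<^sup>2) * norm (iA (iA x)))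
      = 2 * t\<^sup>2 * norm (iA (iA x)) * (1 / 2) ^ k"
    by (simp add: power2_eq_square power_one_over field_simps)
  finally show ?thesis .
qed

text \<open>Summing the geometric series of the halving errors. As the bound stays below 4 t^2 |A^2 x| for
  all k, the limit differs from a single Euler step only to second order in t.\<close>

lemma euler_minus_resolvent:
  assumes "x \<in> D2"
  shows "norm (euler k t x - resolvent t x) \<le> 4 * t\<^sup>2 * norm (iA (iA x)) * (1 - (1 / 2) ^ k)"
proof (induction k)
  case (Suc k)
  have "norm (euler (Suc k) t x - resolvent t x)
      \<le> norm (euler (Suc k) t x - euler k t x) + norm (euler k t x - resolvent t x)"
    using norm_triangle_ineq[of "euler (Suc k) t x - euler k t x" "euler k t x - resolvent t x"] by simp
  then show ?case
    using Suc euler_step[OF assms, of k t] by (simp add: algebra_simps)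
qed (simp add: euler_def)

text \<open>On the domain of A^2 the halving errors are summable, and this domain is dense.\<close>

lemma euler_convergent: "convergent (\<lambda>k. euler k t x)"
proof (rule contractions_convergent_dense[OF contraction_euler D2_dense])
  fix x assume x: "x \<in> D2"
  have "summable (\<lambda>k. 2 * t\<^sup>2 * norm (iA (iA x)) * (1 / 2) ^ k)"
    by (intro summable_mult summable_geometric) simp
  then have "summable (\<lambda>k. euler (Suc k) t x - euler k t x)"
    by (rule summable_comparison_test') (rule euler_step[OF x])
  then have "(\<lambda>n. \<Sum>k<n. euler (Suc k) t x - euler k t x) \<longlonglongrightarrow> (\<Sum>k. euler (Suc k) t x - euler k t x)"
    by (rule summable_LIMSEQ)
  then have "convergent (\<lambda>n. euler n t x - euler 0 t x)"
    unfolding convergent_def sum_lessThan_telescope[of "\<lambda>k. euler k t x"] by blast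
  then show "convergent (\<lambda>n. euler n t x)"
    using convergent_diff_const_right_iff by blast
qed

definition evolution :: "real \<Rightarrow> 'a \<Rightarrow> 'a"
  where "evolution t x = lim (\<lambda>k. euler k t x)"

lemma euler_tendsto: "(\<lambda>k. euler k t x) \<longlonglongrightarrow> evolution t x"
  using euler_convergent unfolding evolution_def by (simp add: convergent_LIMSEQ_iff)

lemma contraction_evolution: "contraction (evolution t)"
  by (rule contraction_limit[OF contraction_euler euler_tendsto])

lemma evolution_zero: "evolution 0 x = x"
proof -
  have "resolvent 0 = id" by (simp add: fun_eq_iff)
  then have "euler k 0 x = x" for k
    by (simp add: euler_def)
  then show ?thesis
    using euler_tendsto[of 0 x] by (simp add: LIMSEQ_const_iff)
qed

text \<open>Before the limit, the group law fails by 2^k local errors of size O(4^{-k}).\<close>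

lemma evolution_add: "evolution (s + t) x = evolution s (evolution t x)"
proof (rule contractions_eq_dense[OF contraction_evolution
      contraction_comp[OF contraction_evolution contraction_evolution] D2_dense])
  fix x assume x: "x \<in> D2"
  have "norm (euler k (s + t) x - euler k s (euler k t x))
      \<le> 2 * (\<bar>s\<bar> + \<bar>t\<bar>)\<^sup>2 * norm (iA (iA x)) * (1 / 2) ^ k" for k
  proof -
    define g h where "g = s / 2 ^ k" and "h = t / 2 ^ k"
    have gh: "\<bar>g\<bar> + \<bar>h\<bar> = (\<bar>s\<bar> + \<bar>t\<bar>) / 2 ^ k"
      by (simp add: g_def h_def add_divide_distrib)
    have 1: "euler k (s + t) = resolvent (g + h) ^^ (2 ^ k)"
      by (simp add: euler_def g_def h_def add_divide_distrib)
    have 2: "euler k s (euler k t x) = ((\<lambda>x. resolvent g (resolvent h x)) ^^ (2 ^ k)) x"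
      unfolding euler_def g_def h_def
      by (rule funpow_comp_commuting[symmetric]) (rule resolvents_commute)
    have "norm (euler k (s + t) x - euler k s (euler k t x))
        \<le> real (2 ^ k) * norm (resolvent (g + h) x - resolvent g (resolvent h x))"
      unfolding 1 2
    proof (rule contraction_power_diff)
      show "resolvent (g + h) (resolvent g (resolvent h x)) = resolvent g (resolvent h (resolvent (g + h) x))" for x
        by (simp only: resolvents_commute[of "g + h"])
    qed (simp_all add: contraction_resolvent contraction_comp)
    also have "\<dots> \<le> real (2 ^ k) * (2 * (\<bar>g\<bar> + \<bar>h\<bar>)\<^sup>2 * norm (iA (iA x)))"
      by (intro mult_left_mono resolvent_add_error x) simp
    also have "\<dots> = 2 * (\<bar>s\<bar> + \<bar>t\<bar>)\<^sup>2 * norm (iA (iA x)) * (1 / 2) ^ k"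
      unfolding gh by (simp add: power_divide power2_eq_square power_one_over field_simps)
    finally show ?thesis .
  qed
  moreover have "(\<lambda>k. 2 * (\<bar>s\<bar> + \<bar>t\<bar>)\<^sup>2 * norm (iA (iA x)) * (1 / 2) ^ k) \<longlonglongrightarrow> 0"
    by (intro tendsto_mult_right_zero LIMSEQ_power_zero) simp
  ultimately have "(\<lambda>k. euler k (s + t) x - euler k s (euler k t x)) \<longlonglongrightarrow> 0"
    by - (rule Lim_null_comparison, auto)
  moreover have "(\<lambda>k. euler k (s + t) x - euler k s (euler k t x))
      \<longlonglongrightarrow> evolution (s + t) x - evolution s (evolution t x)"
    by (rule tendsto_diff[OF euler_tendsto
          contractions_tendsto_comp[OF contraction_euler euler_tendsto euler_tendsto]])
  ultimately have "0 = evolution (s + t) x - evolution s (evolution t x)"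
    by (rule LIMSEQ_unique)
  then show "evolution (s + t) x = evolution s (evolution t x)"
    by simp
qed

lemma evolution_inverse: "evolution (- t) (evolution t x) = x"
  using evolution_add[of "- t" t x] by (simp add: evolution_zero)

text \<open>A group of contractions consists of isometries, since the inverses are contractions too.\<close>

lemma evolution_norm: "norm (evolution t x) = norm x"
  using contraction_norm[OF contraction_evolution, of t x]
    contraction_norm[OF contraction_evolution, of "- t" "evolution t x"]
  by (simp add: evolution_inverse)

text \<open>This Lipschitz bound involves only i A x, not its square. It is what allows passing from the domain
  of A^2 to the whole domain of A in the computation of the generator.\<close>

lemma evolution_minus_id:
  assumes "x \<in> D"
  shows "norm (evolution t x - x) \<le> \<bar>t\<bar> * norm (iA x)"
proof (rule LIMSEQ_le_const2)
  show "(\<lambda>k. norm (euler k t x - x)) \<longlonglongrightarrow> norm (evolution t x - x)"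
    by (intro tendsto_intros euler_tendsto)
  have "norm (euler k t x - x) \<le> \<bar>t\<bar> * norm (iA x)" for k
  proof -
    have "norm (euler k t x - (id ^^ (2 ^ k)) x) \<le> real (2 ^ k) * norm (resolvent (t / 2 ^ k) x - id x)"
      unfolding euler_def
      by (rule contraction_power_diff) (simp_all add: contraction_resolvent contraction_id)
    also have "\<dots> \<le> real (2 ^ k) * (\<bar>t / 2 ^ k\<bar> * norm (iA x))"
      using resolvent_minus_id[OF assms, of "t / 2 ^ k"] by (intro mult_left_mono) simp_all
    also have "\<dots> = \<bar>t\<bar> * norm (iA x)" by simp
    finally show ?thesis by simp
  qed
  then show "\<exists>N. \<forall>k\<ge>N. norm (euler k t x - x) \<le> \<bar>t\<bar> * norm (iA x)" by blast
qed

lemma evolution_tendsto_id: "((\<lambda>h. evolution h x) \<longlongrightarrow> x) (at 0)"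
proof -
  have "((\<lambda>h. evolution h x - id x) \<longlongrightarrow> 0) (at 0)"
  proof (rule contractions_diff_tendsto_dense[OF contraction_evolution contraction_id domain_dense])
    fix x assume "x \<in> D"
    have "((\<lambda>h. \<bar>h\<bar> * norm (iA x)) \<longlongrightarrow> 0) (at 0)"
      by (intro tendsto_eq_intros) auto
    then show "((\<lambda>h. evolution h x - id x) \<longlongrightarrow> 0) (at 0)"
      by (rule Lim_null_comparison[rotated]) (simp add: evolution_minus_id[OF \<open>x \<in> D\<close>])
  qed
  then show ?thesis by (simp add: LIM_zero_cancel)
qed

lemma unitary_group_evolution: "unitary_group evolution"
  unfolding unitary_group_def
proof (intro conjI allI)
  show "unitary (evolution t)" for t
    unfolding unitary_def
  proof (intro conjI allI)
    show "linear_operator UNIV (evolution t)"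
      using contraction_evolution by (simp add: contraction_def)
    show "surj (evolution t)"
      using evolution_inverse[of "- t"] by (metis minus_minus surjI)
    show "cinner (evolution t x) (evolution t y) = cinner x y" for x y
      by (rule isometry_cinner[OF contraction_evolution evolution_norm])
  qed
  show "evolution 0 = id"
    by (simp add: fun_eq_iff evolution_zero)
  show "evolution (s + t) = evolution s \<circ> evolution t" for s t
    by (simp add: fun_eq_iff evolution_add)
  show "continuous_on UNIV (\<lambda>t. evolution t x)" for x
  proof (intro continuous_at_imp_continuous_on ballI)
    fix t :: real
    have "((\<lambda>h. evolution t (evolution h x)) \<longlongrightarrow> evolution t x) (at 0)"
      by (rule contraction_tendsto[OF contraction_evolution evolution_tendsto_id])
    then show "isCont (\<lambda>t. evolution t x) t"
      by (simp add: isCont_iff evolution_add)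
  qed
qed

lemma evolution_minus_resolvent:
  assumes "x \<in> D2"
  shows "norm (evolution t x - resolvent t x) \<le> 4 * t\<^sup>2 * norm (iA (iA x))"
proof (rule LIMSEQ_le_const2)
  show "(\<lambda>k. norm (euler k t x - resolvent t x)) \<longlonglongrightarrow> norm (evolution t x - resolvent t x)"
    by (intro tendsto_intros euler_tendsto)
  have "norm (euler k t x - resolvent t x) \<le> 4 * t\<^sup>2 * norm (iA (iA x))" for k
  proof (rule order_trans[OF euler_minus_resolvent[OF assms]])
    show "4 * t\<^sup>2 * norm (iA (iA x)) * (1 - (1 / 2) ^ k) \<le> 4 * t\<^sup>2 * norm (iA (iA x))"
      by (rule mult_left_le) simp_all
  qed
  then show "\<exists>N. \<forall>k\<ge>N. norm (euler k t x - resolvent t x) \<le> 4 * t\<^sup>2 * norm (iA (iA x))" by blast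
qed

lemma evolution_quotient_D2:
  assumes "x \<in> D2" "h \<noteq> 0"
  shows "norm ((evolution h x - x) /\<^sub>R h - iA x) \<le> 5 * norm (iA (iA x)) * \<bar>h\<bar>"
proof -
  let ?M = "norm (iA (iA x))"
  have "h *\<^sub>R ((evolution h x - x) /\<^sub>R h - iA x) = evolution h x - x - h *\<^sub>R iA x"
    using assms(2) by (simp add: scaleR_diff_right)
  moreover have "evolution h x - x - h *\<^sub>R iA x
      = (evolution h x - resolvent h x) + h\<^sup>2 *\<^sub>R resolvent h (iA (iA x))"
    using resolvent_taylor2[OF assms(1), of h] by simp
  ultimately have "\<bar>h\<bar> * norm ((evolution h x - x) /\<^sub>R h - iA x)
      = norm ((evolution h x - resolvent h x) + h\<^sup>2 *\<^sub>R resolvent h (iA (iA x)))"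
    by (metis norm_scaleR)
  also have "\<dots> \<le> norm (evolution h x - resolvent h x) + norm (h\<^sup>2 *\<^sub>R resolvent h (iA (iA x)))"
    by (rule norm_triangle_ineq)
  also have "\<dots> \<le> 4 * h\<^sup>2 * ?M + h\<^sup>2 * ?M"
    by (intro add_mono evolution_minus_resolvent assms)
      (simp add: mult_left_mono contraction_norm[OF contraction_resolvent])
  also have "\<dots> = \<bar>h\<bar> * (5 * ?M * \<bar>h\<bar>)"
    by (simp add: power2_eq_square abs_mult_self_eq algebra_simps)
  finally show ?thesis using assms(2) by simp
qed

text \<open>On the domain of A^2 the difference quotient converges by the second-order estimate. A general x in
  the domain is approximated by w = mollify n x in the graph norm; the quotient of the remainder x - w
  is at most |i A (x - w)| for every h.\<close>

lemma evolution_has_generator: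
  assumes "x \<in> D"
  shows "((\<lambda>h. (evolution h x - x) /\<^sub>R h) \<longlongrightarrow> iA x) (at 0)"
proof (rule tendstoI)
  fix e :: real assume "e > 0"
  have "(\<lambda>n. mollify n (iA x)) \<longlonglongrightarrow> iA x" by (rule mollify_tendsto)
  then obtain n where n: "norm (iA x - mollify n (iA x)) < e / 3"
    using \<open>e > 0\<close> by (metis LIMSEQ_iff norm_minus_commute order_refl zero_less_divide_iff zero_less_numeral)
  define w where "w = mollify n x"
  have w: "w \<in> D2" "w \<in> D" "x - w \<in> D" and iAw: "norm (iA (x - w)) < e / 3"
    using mollify_in_D2[of n x] n
    by (auto simp: w_def D2_def domain_diff assms iA_diff mollify_commutes)
  have "((\<lambda>h. 5 * norm (iA (iA w)) * \<bar>h\<bar>) \<longlongrightarrow> 0) (at 0)"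
    by (intro tendsto_eq_intros) auto
  then have small: "\<forall>\<^sub>F h in at 0. 5 * norm (iA (iA w)) * \<bar>h\<bar> < e / 3"
    by (rule order_tendstoD(2)) (simp add: \<open>e > 0\<close>)
  have ne: "\<forall>\<^sub>F h in at 0. h \<noteq> (0::real)"
    by (simp add: eventually_at_filter)
  from small show "\<forall>\<^sub>F h in at 0. dist ((evolution h x - x) /\<^sub>R h) (iA x) < e"
    using ne
  proof eventually_elim
    fix h :: real assume h: "5 * norm (iA (iA w)) * \<bar>h\<bar> < e / 3" "h \<noteq> 0"
    have 1: "norm ((evolution h (x - w) - (x - w)) /\<^sub>R h) \<le> norm (iA (x - w))"
    proof -
      have "norm ((evolution h (x - w) - (x - w)) /\<^sub>R h)
          = inverse \<bar>h\<bar> * norm (evolution h (x - w) - (x - w))"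
        by simp
      also have "\<dots> \<le> inverse \<bar>h\<bar> * (\<bar>h\<bar> * norm (iA (x - w)))"
        by (intro mult_left_mono evolution_minus_id w(3)) simp
      also have "\<dots> = norm (iA (x - w))"
        using h(2) by simp
      finally show ?thesis .
    qed
    have 2: "norm ((evolution h w - w) /\<^sub>R h - iA w) < e / 3"
      using evolution_quotient_D2[OF w(1) h(2)] h(1) by simp
    have split: "(evolution h x - x) /\<^sub>R h - iA x = (evolution h (x - w) - (x - w)) /\<^sub>R h
        + ((evolution h w - w) /\<^sub>R h - iA w) - iA (x - w)"
      by (simp add: contraction_diff[OF contraction_evolution] iA_diff w assms algebra_simps)
    have "norm (p + q - r) \<le> norm p + norm q + norm r" for p q r :: 'a
      using norm_triangle_ineq4[of "p + q" r] norm_triangle_ineq[of p q] by linarith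
    then have "norm ((evolution h x - x) /\<^sub>R h - iA x) \<le> norm ((evolution h (x - w) - (x - w)) /\<^sub>R h)
        + norm ((evolution h w - w) /\<^sub>R h - iA w) + norm (iA (x - w))"
      unfolding split .
    then show "dist ((evolution h x - x) /\<^sub>R h) (iA x) < e"
      using 1 2 iAw by (simp add: dist_norm)
  qed
qed

text \<open>Moving the difference quotient to the other side of the inner product turns its existence at x into
  the weak form of the equation i A x = z, to which the maximality of A applies.\<close>

lemma evolution_generator_maximal:
  assumes lim: "((\<lambda>h. (evolution h x - x) /\<^sub>R h) \<longlongrightarrow> z) (at 0)"
  shows "x \<in> D" and "z = iA x"
proof -
  note C = contraction_evolution
  \<comment> \<open>The adjoint of U(h) is U(- h), so the quotient at x is needed for - h.\<close>
  have "filterlim uminus (at 0) (at (0::real))"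
    by (auto simp: filterlim_at eventually_at_filter intro!: tendsto_eq_intros)
  from filterlim_compose[OF lim this]
  have minus: "((\<lambda>h. (evolution (- h) x - x) /\<^sub>R (- h)) \<longlongrightarrow> z) (at 0)" .
  have adj: "cinner (A w) x = cinner w ((- \<i>) *\<^sub>C z)" if "w \<in> D" for w
  proof -
    have left: "((\<lambda>h. cinner ((evolution h w - w) /\<^sub>R h) x) \<longlongrightarrow> cinner (iA w) x) (at 0)"
      by (intro tendsto_cinner tendsto_const evolution_has_generator that)
    have shift: "cinner ((evolution h w - w) /\<^sub>R h) x = - cinner w ((evolution (- h) x - x) /\<^sub>R (- h))" for h
    proof -
      have "cinner (evolution h w) x = cinner w (evolution (- h) x)"
        using isometry_cinner[OF C evolution_norm, of "- h" "evolution h w" x]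
        by (simp add: evolution_inverse)
      then show ?thesis
        by (simp add: cinner_scaleR_left cinner_scaleR_right cinner_diff_left cinner_diff_right cinner_minus_right)
    qed
    have "((\<lambda>h. - cinner w ((evolution (- h) x - x) /\<^sub>R (- h))) \<longlongrightarrow> - cinner w z) (at 0)"
      by (intro tendsto_minus tendsto_cinner tendsto_const minus)
    from tendsto_unique[OF at_neq_bot left[unfolded shift] this]
    have "cinner (iA w) x = - cinner w z" .
    then have "\<i> * cinner (A w) x = - cinner w z"
      by (simp add: iA_def cinner_scaleC_left)
    then have "\<i> * (\<i> * cinner (A w) x) = \<i> * (- cinner w z)" by simp
    then show ?thesis by (simp add: cinner_scaleC_right)
  qed
  show "x \<in> D" by (rule in_domainI(1)[OF adj])
  have "A x = (- \<i>) *\<^sub>C z" by (rule in_domainI(2)[OF adj])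
  then show "z = iA x" by (simp add: iA_def scaleC_scaleC)
qed

lemma evolution_generates: "generates D iA evolution"
  unfolding generates_def
proof (intro allI iffI conjI)
  fix x z assume lim: "((\<lambda>h. (evolution h x - x) /\<^sub>R h) \<longlongrightarrow> z) (at 0)"
  show "x \<in> D" by (rule evolution_generator_maximal(1)[OF lim])
  show "z = iA x" by (rule evolution_generator_maximal(2)[OF lim])
next
  fix x z assume "x \<in> D \<and> z = iA x"
  then show "((\<lambda>h. (evolution h x - x) /\<^sub>R h) \<longlongrightarrow> z) (at 0)"
    using evolution_has_generator[of x] by (simp only:)
qed

section \<open>Uniqueness of the group\<close>

text \<open>Both groups are n-th powers of their values at time t / n, and these values differ by o(1 / n) on
  the domain, since the groups have the same derivative there.\<close>

lemma generated_group_unique: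
  assumes W: "unitary_group W" and gen: "generates D iA W"
  shows "W = evolution"
proof (intro ext)
  fix t x
  note E = unitary_group_evolution
  have CW: "contraction (W t)" for t by (rule unitary_group_contraction[OF W])
  \<comment> \<open>W commutes with its generator, hence with the resolvents and with their limits.\<close>
  have comm: "W s (evolution t x) = evolution t (W s x)" for s t x
  proof -
    have "W s (resolvent h x) = resolvent h (W s x)" for h x
      by (rule commutes_with_resolvent[OF CW]) (rule generator_commutes[OF W gen], assumption)+
    then have "W s ((resolvent h ^^ n) x) = (resolvent h ^^ n) (W s x)" for h n x
      by (induction n) simp_all
    then have "W s (euler k t x) = euler k t (W s x)" for k
      by (simp add: euler_def)
    moreover have "(\<lambda>k. W s (euler k t x)) \<longlonglongrightarrow> W s (evolution t x)"
      by (rule contraction_tendsto[OF CW euler_tendsto])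
    ultimately show ?thesis
      using euler_tendsto[of t "W s x"] LIMSEQ_unique by simp
  qed
  show "W t x = evolution t x"
  proof (rule contractions_eq_dense[OF CW contraction_evolution domain_dense])
    fix x assume x: "x \<in> D"
    show "W t x = evolution t x"
    proof (cases "t = 0")
      case False
      define h where "h n = t / real (Suc n)" for n
      have h: "filterlim h (at 0) sequentially"
      proof -
        have "h \<longlonglongrightarrow> t * 0"
          unfolding h_def divide_inverse by (intro tendsto_mult tendsto_const LIMSEQ_inverse_real_of_nat)
        then show ?thesis using False by (simp add: filterlim_at h_def)
      qed
      let ?q = "\<lambda>U n. (U (h n) x - x) /\<^sub>R h n"
      have bound: "norm (W t x - evolution t x) \<le> \<bar>t\<bar> * norm (?q W n - ?q evolution n)" for n
      proof -
        have t: "t = real (Suc n) * h n" by (simp add: h_def)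
        have eq: "W t x - evolution t x = (W (h n) ^^ Suc n) x - (evolution (h n) ^^ Suc n) x"
          by (simp only: t unitary_group_mult[OF W, symmetric] unitary_group_mult[OF E, symmetric])
        have "norm (W t x - evolution t x) \<le> real (Suc n) * norm (W (h n) x - evolution (h n) x)"
          unfolding eq by (rule contraction_power_diff[OF CW contraction_evolution]) (rule comm)
        also have "W (h n) x - evolution (h n) x = h n *\<^sub>R (?q W n - ?q evolution n)"
          using False by (simp add: h_def scaleR_diff_right)
        also have "real (Suc n) * norm (h n *\<^sub>R (?q W n - ?q evolution n)) = \<bar>t\<bar> * norm (?q W n - ?q evolution n)"
          by (simp add: h_def)
        finally show ?thesis .
      qed
      have "(\<lambda>n. \<bar>t\<bar> * norm (?q W n - ?q evolution n)) \<longlonglongrightarrow> \<bar>t\<bar> * norm (iA x - iA x)"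
        by (rule tendsto_mult[OF tendsto_const tendsto_norm[OF tendsto_diff[OF
          filterlim_compose[OF generatesD(1)[OF gen x] h] filterlim_compose[OF evolution_has_generator[OF x] h]]]])
      then have "norm (W t x - evolution t x) \<le> \<bar>t\<bar> * norm (iA x - iA x)"
        by (rule LIMSEQ_le_const) (use bound in blast)
      then show ?thesis by simp
    qed (simp add: unitary_group_zero[OF W] evolution_zero)
  qed
qed

text \<open>Stone's theorem for A, as existence and uniqueness in the definite description.\<close>

lemma exp_i_eq_evolution: "exp_i D A = evolution"
  unfolding exp_i_def iA_def[symmetric]
proof (rule the_equality)
  show "unitary_group evolution \<and> generates D (\<lambda>x. iA x) evolution"
    using unitary_group_evolution evolution_generates by simp
  show "U = evolution" if "unitary_group U \<and> generates D (\<lambda>x. iA x) U" for U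
    using generated_group_unique that by simp
qed

section \<open>Duhamel's integral\<close>

lemma exp_i_unitary_group: "unitary_group (exp_i D A)"
  by (simp only: exp_i_eq_evolution unitary_group_evolution)

lemma exp_i_generates: "generates D iA (exp_i D A)"
  by (simp only: exp_i_eq_evolution evolution_generates)

lemmas contraction_exp_i = unitary_group_contraction[OF exp_i_unitary_group]

lemma exp_i_has_vector_derivative:
  assumes "x \<in> D"
  shows "((\<lambda>t. exp_i D A t x) has_vector_derivative exp_i D A t (iA x)) (at t)"
proof -
  let ?U = "exp_i D A"
  have "((\<lambda>h. ?U t ((?U h x - x) /\<^sub>R h)) \<longlongrightarrow> ?U t (iA x)) (at 0)"
    by (rule contraction_tendsto[OF contraction_exp_i generatesD(1)[OF exp_i_generates assms]])
  moreover have "?U t ((?U h x - x) /\<^sub>R h) = (?U (t + h) x - ?U t x) /\<^sub>R h" for h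
    by (simp add: unitary_group_add[OF exp_i_unitary_group] contraction_scaleR[OF contraction_exp_i]
        contraction_diff[OF contraction_exp_i])
  ultimately have "((\<lambda>h. (?U (t + h) x - ?U t x) /\<^sub>R h) \<longlongrightarrow> ?U t (iA x)) (at 0)"
    by simp
  then have "((\<lambda>h. (?U (t + h) x - ?U t x) /\<^sub>R h - ?U t (iA x)) \<longlongrightarrow> 0) (at 0)"
    by (rule LIM_zero)
  then have lim: "((\<lambda>h. norm ((?U (t + h) x - ?U t x) /\<^sub>R h - ?U t (iA x))) \<longlongrightarrow> 0) (at 0)"
    by (rule tendsto_norm_zero)
  have "((\<lambda>h. norm (?U (t + h) x - ?U t x - h *\<^sub>R ?U t (iA x)) / norm h) \<longlongrightarrow> 0) (at 0)"
  proof (rule Lim_transform_eventually[OF lim])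
    have "norm ((?U (t + h) x - ?U t x) /\<^sub>R h - ?U t (iA x))
        = norm (?U (t + h) x - ?U t x - h *\<^sub>R ?U t (iA x)) / norm h" if "h \<noteq> 0" for h
    proof -
      have "(?U (t + h) x - ?U t x) /\<^sub>R h - ?U t (iA x) = (?U (t + h) x - ?U t x - h *\<^sub>R ?U t (iA x)) /\<^sub>R h"
        using that by (simp add: scaleR_diff_right)
      then show ?thesis
        by (simp only: norm_scaleR abs_inverse real_norm_def divide_inverse mult.commute)
    qed
    then show "\<forall>\<^sub>F h in at 0. norm ((?U (t + h) x - ?U t x) /\<^sub>R h - ?U t (iA x))
        = norm (?U (t + h) x - ?U t x - h *\<^sub>R ?U t (iA x)) / norm h"
      by (simp add: eventually_at_filter)
  qed
  then show ?thesis
    unfolding has_vector_derivative_def has_derivative_at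
    by (simp add: bounded_linear_scaleR_left)
qed

text \<open>The mild solution for the datum g is \<open>duhamel a t (- i g)\<close>; an arbitrary integrand vector is needed
  because the estimates use this integral at y and w as well.\<close>

definition duhamel :: "real \<Rightarrow> real \<Rightarrow> 'a \<Rightarrow> 'a"
  where "duhamel a t v = integral {0..t} (\<lambda>s. exp_i_damped D A a (t - s) v)"

lemma duhamel_integrable: "(\<lambda>s. exp_i_damped D A a (t - s) v) integrable_on {0..t}"
proof (rule integrable_continuous_real)
  have "continuous_on {0..t} (\<lambda>s. exp_i D A (t - s) v)"
    by (rule continuous_on_compose2[OF unitary_group_continuous[OF exp_i_unitary_group]])
      (auto intro!: continuous_intros)
  then show "continuous_on {0..t} (\<lambda>s. exp_i_damped D A a (t - s) v)"
    unfolding exp_i_damped_def by (intro continuous_intros)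
qed

lemma duhamel_add: "duhamel a t (v + w) = duhamel a t v + duhamel a t w"
proof -
  have "exp_i_damped D A a s (v + w) = exp_i_damped D A a s v + exp_i_damped D A a s w" for s
    by (simp add: exp_i_damped_def contraction_add[OF contraction_exp_i] scaleR_add_right)
  then show ?thesis
    unfolding duhamel_def by (simp add: integral_add[OF duhamel_integrable duhamel_integrable])
qed

lemma duhamel_minus: "duhamel a t (- v) = - duhamel a t v"
proof -
  have "duhamel a t (- v) + duhamel a t v = duhamel a t 0"
    by (simp flip: duhamel_add)
  also have "\<dots> = 0"
    using duhamel_add[of a t 0 0] by simp
  finally show ?thesis
    by (simp add: add_eq_0_iff2)
qed

lemma norm_duhamel_le:
  assumes "a > 0" "t \<ge> 0"
  shows "norm (duhamel a t v) \<le> norm v / a"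
proof -
  have "((\<lambda>s. exp (- a * (t - s)) / a) has_real_derivative exp (- a * (t - s))) (at s within {0..t})" for s
    using assms(1) by (auto intro!: derivative_eq_intros)
  then have int: "((\<lambda>s. exp (- a * (t - s))) has_integral exp (- a * (t - t)) / a - exp (- a * (t - 0)) / a) {0..t}"
    using assms(2) by (intro fundamental_theorem_of_calculus)
      (simp_all flip: has_real_derivative_iff_has_vector_derivative)
  have int': "((\<lambda>s. exp (- a * (t - s)) * norm v) has_integral (1 / a - exp (- a * t) / a) * norm v) {0..t}"
    using has_integral_mult_left[OF int, of "norm v"] by simp
  have "norm (duhamel a t v) \<le> integral {0..t} (\<lambda>s. exp (- a * (t - s)) * norm v)"
    unfolding duhamel_def
    by (rule integral_norm_bound_integral[OF duhamel_integrable has_integral_integrable[OF int']])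
      (simp add: exp_i_damped_def unitary_group_norm[OF exp_i_unitary_group])
  also have "\<dots> = (1 / a - exp (- a * t) / a) * norm v"
    by (rule integral_unique[OF int'])
  also have "\<dots> \<le> (1 / a) * norm v"
    using assms(1) by (intro mult_right_mono) simp_all
  finally show ?thesis by simp
qed

text \<open>The derivative of s \<mapsto> E(t - s) w is - E(t - s) (i A w) + a E(t - s) w, where E denotes the damped
  group; integrate it from 0 to t.\<close>

lemma duhamel_generator:
  assumes w: "w \<in> D" and "t \<ge> 0"
  shows "duhamel a t (iA w) = exp_i_damped D A a t w - w + a *\<^sub>R duhamel a t w"
proof -
  let ?E = "exp_i_damped D A a"
  have F: "((\<lambda>\<tau>. ?E \<tau> w) has_vector_derivative ?E \<tau> (iA w) - a *\<^sub>R ?E \<tau> w) (at \<tau>)" for \<tau>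
  proof -
    have "((\<lambda>\<tau>. exp (- a * \<tau>)) has_real_derivative - a * exp (- a * \<tau>)) (at \<tau>)"
      by (auto intro!: derivative_eq_intros)
    from has_vector_derivative_scaleR[OF this exp_i_has_vector_derivative[OF w]]
    show ?thesis
      by (simp add: exp_i_damped_def)
  qed
  have "((\<lambda>s. ?E (t - s) w) has_vector_derivative - (?E (t - s) (iA w) - a *\<^sub>R ?E (t - s) w)) (at s within {0..t})" for s
  proof -
    have "((\<lambda>s. t - s) has_vector_derivative - 1) (at s)"
      by (auto intro!: derivative_eq_intros)
    from vector_diff_chain_at[OF this F]
    show ?thesis
      by (simp add: comp_def has_vector_derivative_at_within)
  qed
  then have "((\<lambda>s. - (?E (t - s) (iA w) - a *\<^sub>R ?E (t - s) w)) has_integral ?E (t - t) w - ?E (t - 0) w) {0..t}"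
    using assms(2) by (intro fundamental_theorem_of_calculus)
  moreover have "?E 0 w = w"
    by (simp add: exp_i_damped_def unitary_group_zero[OF exp_i_unitary_group])
  ultimately have 1: "((\<lambda>s. - (?E (t - s) (iA w) - a *\<^sub>R ?E (t - s) w)) has_integral w - ?E t w) {0..t}"
    by simp
  have 2: "((\<lambda>s. - (?E (t - s) (iA w) - a *\<^sub>R ?E (t - s) w))
      has_integral - (duhamel a t (iA w) - a *\<^sub>R duhamel a t w)) {0..t}"
    unfolding duhamel_def
    by (intro has_integral_neg has_integral_diff has_integral_cmul integrable_integral duhamel_integrable)
  show ?thesis
    using has_integral_unique[OF 1 2] by (simp add: algebra_simps)
qed

section \<open>Convergence of the regularized solution\<close>

lemma norm_exp_i_damped: "norm (exp_i_damped D A a t w) = exp (- a * t) * norm w"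
  by (simp add: exp_i_damped_def unitary_group_norm[OF exp_i_unitary_group])

lemma iA_range_csubspace: "csubspace (iA ` D)"
  unfolding csubspace_def
proof (intro conjI ballI allI)
  show "0 \<in> iA ` D"
    by (rule image_eqI[of _ _ 0]) (simp_all add: iA_zero domain_zero)
next
  fix v w assume "v \<in> iA ` D" "w \<in> iA ` D"
  then obtain x y where "x \<in> D" "y \<in> D" "v = iA x" "w = iA y"
    by (elim imageE)
  then show "v + w \<in> iA ` D"
    by - (rule image_eqI[of _ _ "x + y"], simp_all add: iA_add domain_add)
next
  fix c v assume "v \<in> iA ` D"
  then obtain x where "x \<in> D" "v = iA x"
    by (elim imageE)
  then show "c *\<^sub>C v \<in> iA ` D"
    by - (rule image_eqI[of _ _ "c *\<^sub>C x"], simp_all add: iA_scaleC domain_scaleC)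
qed

text \<open>The residual of the projection of y onto the closure of the range is orthogonal to the range, hence
  in the null space by maximality, hence orthogonal to y and to itself.\<close>

lemma orthogonal_null_space_closure_range:
  assumes "orthogonal_to y (null_space D A)"
  shows "y \<in> closure (iA ` D)"
proof -
  obtain p where p: "p \<in> closure (iA ` D)" and orth: "\<And>s. s \<in> closure (iA ` D) \<Longrightarrow> cinner (y - p) s = 0"
    using orthogonal_projection_exists[OF csubspace_closure[OF iA_range_csubspace] closed_closure, of y]
    by blast
  have adj: "cinner (A x) (y - p) = cinner x 0" if "x \<in> D" for x
  proof -
    have "cinner (y - p) (iA x) = 0"
      using orth that closure_subset by blast
    then have "cinner (y - p) (A x) = 0"
      by (simp add: iA_def cinner_scaleC_right)
    then show ?thesis
      using cinner_commute[of "A x" "y - p"] by simp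
  qed
  have "y - p \<in> D" by (rule in_domainI(1)[OF adj])
  moreover have "A (y - p) = 0" by (rule in_domainI(2)[OF adj])
  ultimately have "cinner y (y - p) = 0"
    using assms by (simp add: orthogonal_to_def null_space_def)
  moreover have "cinner p (y - p) = 0"
    using orth[OF p] cinner_commute[of p "y - p"] by simp
  ultimately have "cinner (y - p) (y - p) = 0"
    by (simp add: cinner_diff_left)
  then have "y = p" by (simp add: cinner_self)
  then show ?thesis using p by simp
qed

text \<open>The four terms are the transient, the regular part of the ergodic average a J(y), its irregular part
  and the noise. The free parameter w trades the second term, which vanishes with a, against
  the third, which can be made small in advance if y lies in the closure of the range.\<close>

lemma norm_mild_solution_diff_le:
  assumes y: "y \<in> D" and w: "w \<in> D" and a: "a > 0" and t: "t \<ge> 0"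
  shows "norm (mild_solution D A a g t - y)
    \<le> exp (- a * t) * norm y + 3 * a * norm w + norm (y - iA w) + norm (g - A y) / a"
proof -
  let ?J = "duhamel a t" and ?E = "exp_i_damped D A a t"
  have damped: "norm (?E v) \<le> norm v" for v
    using a t by (simp add: norm_exp_i_damped mult_left_le_one_le)
  have "(- \<i>) *\<^sub>C g = - iA y + (- \<i>) *\<^sub>C (g - A y)"
    by (simp add: iA_def scaleC_diff_right scaleC_minus_left)
  then have "mild_solution D A a g t = - ?J (iA y) + ?J ((- \<i>) *\<^sub>C (g - A y))"
    unfolding mild_solution_def duhamel_def[symmetric] by (simp only: duhamel_add duhamel_minus)
  moreover have "?J (iA y) = ?E y - y + a *\<^sub>R ?J y"
    by (rule duhamel_generator[OF y t])
  moreover have "?J y = ?J (iA w) + ?J (y - iA w)"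
    by (simp flip: duhamel_add)
  ultimately have eq: "mild_solution D A a g t - y
      = - ?E y - a *\<^sub>R ?J (iA w) - a *\<^sub>R ?J (y - iA w) + ?J ((- \<i>) *\<^sub>C (g - A y))"
    by (simp add: algebra_simps)
  \<comment> \<open>The integral of a derivative is bounded independently of a and t; the constant 3 counts its
     boundary terms and the damping term.\<close>
  have "norm (?J (iA w)) \<le> norm (?E w) + norm w + norm (a *\<^sub>R ?J w)"
    unfolding duhamel_generator[OF w t]
    using norm_triangle_ineq4[of "?E w" w] norm_triangle_ineq[of "?E w - w" "a *\<^sub>R ?J w"] by linarith
  moreover have scaled: "norm (a *\<^sub>R ?J v) \<le> norm v" for v
    using norm_duhamel_le[OF a t, of v] a by (simp add: pos_le_divide_eq mult.commute)
  ultimately have "norm (?J (iA w)) \<le> 3 * norm w"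
    using damped[of w] scaled[of w] by linarith
  then have 1: "norm (a *\<^sub>R ?J (iA w)) \<le> 3 * a * norm w"
    using a by simp
  have 2: "norm (?J ((- \<i>) *\<^sub>C (g - A y))) \<le> norm (g - A y) / a"
    using norm_duhamel_le[OF a t, of "(- \<i>) *\<^sub>C (g - A y)"] by (simp add: norm_scaleC)
  have "norm (- p - q - r + s) \<le> norm p + norm q + norm r + norm s" for p q r s :: 'a
    using norm_triangle_ineq4[of "- p" q] norm_triangle_ineq4[of "- p - q" r] norm_triangle_ineq[of "- p - q - r" s]
    by simp
  from this[of "?E y" "a *\<^sub>R ?J (iA w)" "a *\<^sub>R ?J (y - iA w)" "?J ((- \<i>) *\<^sub>C (g - A y))"]
  show ?thesis
    unfolding eq using 1 2 scaled[of "y - iA w"] norm_exp_i_damped[of a t y] by linarith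
qed

end

theorem theorem2:
  fixes D :: "'a::complex_hilbert set"
    and A :: "'a \<Rightarrow> 'a"
    and f y :: 'a
    and f\<^sub>\<delta> :: "real \<Rightarrow> 'a"
  assumes "selfadjoint D A"
    and "y \<in> D"
    and "A y = f"
    and "orthogonal_to y (null_space D A)"
    and "\<And>\<delta>. \<delta> > 0 \<Longrightarrow> norm (f\<^sub>\<delta> \<delta> - f) \<le> \<delta>"
  shows "\<exists>(t :: real \<Rightarrow> real) (a :: real \<Rightarrow> real).
    (\<forall>\<delta>>0. t \<delta> \<ge> 0) \<and> filterlim t at_top (at_right 0) \<and>
    (\<forall>\<delta>>0. a \<delta> > 0) \<and> (a \<longlongrightarrow> 0) (at_right 0) \<and>
    ((\<lambda>\<delta>. norm (mild_solution D A (a \<delta>) (f\<^sub>\<delta> \<delta>) (t \<delta>) - y)) \<longlongrightarrow> 0) (at_right 0)"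
proof -
  interpret selfadjoint_operator D A by unfold_locales (rule assms(1))
  \<comment> \<open>The damping sqrt \<delta> and the time 1 / \<delta> make \<delta> / a = sqrt \<delta> and a t = 1 / sqrt \<delta>.\<close>
  define t :: "real \<Rightarrow> real" where "t \<delta> = inverse \<delta>" for \<delta>
  let ?u = "\<lambda>\<delta>. mild_solution D A (sqrt \<delta>) (f\<^sub>\<delta> \<delta>) (t \<delta>)"
  have sqrt: "(sqrt \<longlongrightarrow> 0) (at_right 0)"
    using tendsto_real_sqrt[OF tendsto_ident_at, of 0 "{0<..}"] by simp
  have pos: "\<forall>\<^sub>F \<delta> in at_right 0. (0::real) < \<delta>"
    by (simp add: eventually_at_right_less)
  have bound: "norm (?u \<delta> - y) \<le> sqrt \<delta> * (norm y + 3 * norm w + 1) + norm (y - iA w)"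
    if "\<delta> > 0" "w \<in> D" for \<delta> w
  proof -
    have s: "sqrt \<delta> * sqrt \<delta> = \<delta>" "sqrt \<delta> > 0"
      using that(1) by simp_all
    have exponent: "sqrt \<delta> * t \<delta> = inverse (sqrt \<delta>)"
      using s by (simp add: t_def field_simps)
    \<comment> \<open>The bound exp (- x) \<le> 1 / x at x = 1 / sqrt \<delta> puts the transient on the scale of the other terms.\<close>
    have "inverse (sqrt \<delta>) \<le> exp (inverse (sqrt \<delta>))"
      using exp_ge_add_one_self[of "inverse (sqrt \<delta>)"] by linarith
    then have "inverse (exp (inverse (sqrt \<delta>))) \<le> inverse (inverse (sqrt \<delta>))"
      using s(2) by (intro le_imp_inverse_le) simp_all
    then have decay: "exp (- sqrt \<delta> * t \<delta>) \<le> sqrt \<delta>"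
      using exponent by (simp add: exp_minus)
    have noise: "norm (f\<^sub>\<delta> \<delta> - A y) / sqrt \<delta> \<le> sqrt \<delta>"
      using assms(5)[OF that(1)] s assms(3) by (simp add: pos_divide_le_eq)
    have "norm (?u \<delta> - y) \<le> exp (- sqrt \<delta> * t \<delta>) * norm y + 3 * sqrt \<delta> * norm w + norm (y - iA w)
        + norm (f\<^sub>\<delta> \<delta> - A y) / sqrt \<delta>"
      using that by (intro norm_mild_solution_diff_le assms) (simp_all add: t_def)
    also have "\<dots> \<le> sqrt \<delta> * norm y + 3 * sqrt \<delta> * norm w + norm (y - iA w) + sqrt \<delta>"
      using decay noise that(1) by (intro add_mono mult_right_mono) simp_all
    finally show ?thesis by (simp add: algebra_simps)
  qed
  have "((\<lambda>\<delta>. norm (?u \<delta> - y)) \<longlongrightarrow> 0) (at_right 0)"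
  proof (rule tendstoI)
    fix e :: real assume "e > 0"
    obtain w where w: "w \<in> D" "norm (y - iA w) < e / 2"
      using orthogonal_null_space_closure_range[OF assms(4)] \<open>e > 0\<close>
        closure_approachableD[of y "iA ` D" "e / 2"] by (auto simp: dist_norm)
    have "((\<lambda>\<delta>. sqrt \<delta> * (norm y + 3 * norm w + 1)) \<longlongrightarrow> 0) (at_right 0)"
      by (rule tendsto_mult_left_zero[OF sqrt])
    then have "\<forall>\<^sub>F \<delta> in at_right 0. sqrt \<delta> * (norm y + 3 * norm w + 1) < e / 2"
      by (rule order_tendstoD(2)) (simp add: \<open>e > 0\<close>)
    with pos show "\<forall>\<^sub>F \<delta> in at_right 0. dist (norm (?u \<delta> - y)) 0 < e"
    proof eventually_elim
      fix \<delta> :: real assume "0 < \<delta>" "sqrt \<delta> * (norm y + 3 * norm w + 1) < e / 2"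
      then show "dist (norm (?u \<delta> - y)) 0 < e"
        using bound[OF \<open>0 < \<delta>\<close> w(1)] w(2) by simp
    qed
  qed
  moreover have "filterlim t at_top (at_right 0)"
    unfolding t_def[abs_def] by (rule filterlim_inverse_at_top_right)
  ultimately show ?thesis
    using sqrt by (intro exI[of _ t] exI[of _ sqrt]) (auto simp: t_def)
qed

end
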